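(* Let $N\in\mathbb{N}$ and let $\vec v_1={}^t[s,c_0,c_1,c_2,c_3,c_4,c_5,\delta]$ be generic complex parameters satisfying the balancing condition $$c_0+c_1+c_2+c_3+c_4+c_5=(2+N)\delta+3s .$$ Then $${}_{10}\widetilde E_9(\vec v_1):=\frac{\prod_{0\le k\le5}[[\delta+s-c_k]]_N}{[[\delta+s]]_N}\;{}_{10}E_9(s;c_0,c_1,c_2,c_3,c_4,c_5,-N\delta)$$ is invariant under the action on $\vec v_1$ of the transformation $b$ and of $s_k$ for all $1\le k\le5$, where $b$ and $s_k$ are defined in the context.
   Context: $[[x]]=\sigma(x;\omega_1,\omega_2)$ is the Weierstrass sigma function with periods $(\omega_1,\omega_2)$ (an odd holomorphic function), $\delta\in\mathbb{C}$ is a fixed constant with $\delta\notin\mathbb{Q}\omega_1+\mathbb{Q}\omega_2$, and $[[z]]_k=[[z]]\,[[z+\delta]]\cdots[[z+(k-1)\delta]]$ for $k=0,1,2,\dots$. The elliptic hypergeometric series is $${}_{r+3}E_{r+2}(s;u_1,\dots,u_r)=\sum_{m\in\mathbb{N}}\frac{[[s+2m\delta]]}{[[s]]}\frac{[[s]]_m}{[[\delta]]_m}\prod_{1\le i\le r}\frac{[[u_i]]_m}{[[\delta+s-u_i]]_m},$$ used here with $r=7$; it terminates because of the parameter $-N\delta$. The transformation $s_k$ ($1\le k\le5$) exchanges $c_{k-1}$ and $c_k$ and fixes the other coordinates of $\vec v_1$, and $$b:\ (s,c_0,c_1,c_2,c_3,c_4,c_5,\delta)\mapsto(2s+\delta-c_0-c_1-c_2,\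 s+\delta-c_1-c_2,\ s+\delta-c_0-c_2,\ s+\delta-c_0-c_1,\ c_3,\ c_4,\ c_5,\ \delta).$$ $N$ is fixed. "Generic" means that all denominators occurring are nonzero. *)

theory Defs
  imports "HOL-Analysis.Analysis"
begin

definition period_lattice :: "complex \<Rightarrow> complex \<Rightarrow> complex set" where
  "period_lattice \<omega>1 \<omega>2 = {of_int m * \<omega>1 + of_int n * \<omega>2 | m n :: int. True}"

text \<open>
  The Weierstrass product for the sigma function. It converges unconditionally, so it is
  taken as a limit along the net of finite sets of nonzero periods (as in the library's
  unconditional sums). The numbers \<open>\<omega>1\<close>, \<open>\<omega>2\<close> are full periods, not half-periods.
\<close>

definition weierstrass_sigma :: "complex \<Rightarrow> complex \<Rightarrow> complex \<Rightarrow> complex" where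
  "weierstrass_sigma \<omega>1 \<omega>2 z =
     z * Lim (finite_subsets_at_top (period_lattice \<omega>1 \<omega>2 - {0}))
           (\<lambda>F. \<Prod>\<omega>\<in>F. (1 - z / \<omega>) * exp (z / \<omega> + (z / \<omega>)\<^sup>2 / 2))"

definition sigma_pochhammer ::
    "complex \<Rightarrow> complex \<Rightarrow> complex \<Rightarrow> complex \<Rightarrow> nat \<Rightarrow> complex" where
  "sigma_pochhammer \<omega>1 \<omega>2 \<delta> z k = (\<Prod>j<k. weierstrass_sigma \<omega>1 \<omega>2 (z + of_nat j * \<delta>))"

text \<open>
  The series \<open>E\<close> with \<open>r + 3\<close> upper and \<open>r + 2\<close> lower indices, where \<open>r\<close> is the length of
  the list \<open>us\<close> of parameters. If some parameter is \<open>- N * \<delta>\<close>, the numerators of all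
  terms with \<open>m > N\<close> vanish.
\<close>

definition ell_hyp_series ::
    "complex \<Rightarrow> complex \<Rightarrow> complex \<Rightarrow> complex \<Rightarrow> complex list \<Rightarrow> complex" where
  "ell_hyp_series \<omega>1 \<omega>2 \<delta> s us =
     (\<Sum>m. weierstrass_sigma \<omega>1 \<omega>2 (s + 2 * of_nat m * \<delta>) / weierstrass_sigma \<omega>1 \<omega>2 s
          * (sigma_pochhammer \<omega>1 \<omega>2 \<delta> s m / sigma_pochhammer \<omega>1 \<omega>2 \<delta> \<delta> m)
          * (\<Prod>u\<leftarrow>us. sigma_pochhammer \<omega>1 \<omega>2 \<delta> u m
                    / sigma_pochhammer \<omega>1 \<omega>2 \<delta> (\<delta> + s - u) m))"

text \<open>
  A parameter vector \<open>(s, c\<^sub>0, \<dots>, c\<^sub>5, \<delta>)\<close> is represented as a triple \<open>(s, c, \<delta>)\<close>; only the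
  values of \<open>c\<close> at \<open>0, \<dots>, 5\<close> are relevant.
\<close>

type_synonym params = "complex \<times> (nat \<Rightarrow> complex) \<times> complex"

fun balanced :: "nat \<Rightarrow> params \<Rightarrow> bool" where
  "balanced N (s, c, \<delta>) \<longleftrightarrow> (\<Sum>k\<le>5. c k) = (2 + of_nat N) * \<delta> + 3 * s"

fun series_params :: "nat \<Rightarrow> params \<Rightarrow> complex list" where
  "series_params N (s, c, \<delta>) = [c 0, c 1, c 2, c 3, c 4, c 5, - of_nat N * \<delta>]"

fun E_tilde :: "complex \<Rightarrow> complex \<Rightarrow> nat \<Rightarrow> params \<Rightarrow> complex" where
  "E_tilde \<omega>1 \<omega>2 N (s, c, \<delta>) =
     (\<Prod>k\<le>5. sigma_pochhammer \<omega>1 \<omega>2 \<delta> (\<delta> + s - c k) N)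
       / sigma_pochhammer \<omega>1 \<omega>2 \<delta> (\<delta> + s) N
       * ell_hyp_series \<omega>1 \<omega>2 \<delta> s (series_params N (s, c, \<delta>))"

text \<open>
  All denominators occurring in \<open>E_tilde\<close> are nonzero. Only the terms \<open>m \<le> N\<close> of the
  series matter, since it terminates.
\<close>

fun generic :: "complex \<Rightarrow> complex \<Rightarrow> nat \<Rightarrow> params \<Rightarrow> bool" where
  "generic \<omega>1 \<omega>2 N (s, c, \<delta>) \<longleftrightarrow>
     sigma_pochhammer \<omega>1 \<omega>2 \<delta> (\<delta> + s) N \<noteq> 0 \<and>
     weierstrass_sigma \<omega>1 \<omega>2 s \<noteq> 0 \<and>
     (\<forall>m\<le>N. sigma_pochhammer \<omega>1 \<omega>2 \<delta> \<delta> m \<noteq> 0 \<and>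
        (\<forall>u\<in>set (series_params N (s, c, \<delta>)).
           sigma_pochhammer \<omega>1 \<omega>2 \<delta> (\<delta> + s - u) m \<noteq> 0))"

fun s_transf :: "nat \<Rightarrow> params \<Rightarrow> params" where
  "s_transf k (s, c, \<delta>) = (s, c(k - 1 := c k, k := c (k - 1)), \<delta>)"

fun b_transf :: "params \<Rightarrow> params" where
  "b_transf (s, c, \<delta>) =
     (2 * s + \<delta> - c 0 - c 1 - c 2,
      c(0 := s + \<delta> - c 1 - c 2, 1 := s + \<delta> - c 0 - c 2, 2 := s + \<delta> - c 0 - c 1),
      \<delta>)"

lemma sum_atMost_5: "(\<Sum>k\<le>5. f k) = f 0 + f 1 + f 2 + f 3 + f 4 + f (5::nat)"
  for f :: "nat \<Rightarrow> complex"
  by (simp add: eval_nat_numeral)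

lemma balanced_b_transf: "balanced N v \<Longrightarrow> balanced N (b_transf v)"
proof (cases v)
  case (fields s c \<delta>)
  assume "balanced N v"
  then have "c 0 + c 1 + c 2 + c 3 + c 4 + c 5 = (2 + of_nat N) * \<delta> + 3 * s"
    by (simp add: fields sum_atMost_5)
  then have "c 3 + c 4 + c 5 = (2 + of_nat N) * \<delta> + 3 * s - c 0 - c 1 - c 2"
    by (simp add: algebra_simps)
  then have c3: "c 3 = (2 + of_nat N) * \<delta> + 3 * s - c 0 - c 1 - c 2 - c 4 - c 5"
    by (simp add: algebra_simps)
  show ?thesis
    by (simp add: fields sum_atMost_5 c3 algebra_simps)
qed

lemma balanced_s_transf:
  assumes "k \<in> {1..5}" "balanced N v"
  shows "balanced N (s_transf k v)"
proof -
  have "k \<in> {1, 2, 3, 4, 5}"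
    using assms(1) by auto
  then show ?thesis
    using assms(2) by (cases v) (auto simp: sum_atMost_5 algebra_simps)
qed

lemma ell_hyp_series_terminates:
  assumes "- of_nat N * \<delta> \<in> set us"
  shows "ell_hyp_series \<omega>1 \<omega>2 \<delta> s us =
     (\<Sum>m\<le>N. weierstrass_sigma \<omega>1 \<omega>2 (s + 2 * of_nat m * \<delta>) / weierstrass_sigma \<omega>1 \<omega>2 s
          * (sigma_pochhammer \<omega>1 \<omega>2 \<delta> s m / sigma_pochhammer \<omega>1 \<omega>2 \<delta> \<delta> m)
          * (\<Prod>u\<leftarrow>us. sigma_pochhammer \<omega>1 \<omega>2 \<delta> u m
                    / sigma_pochhammer \<omega>1 \<omega>2 \<delta> (\<delta> + s - u) m))"
  unfolding ell_hyp_series_def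
proof (rule suminf_finite)
  fix m
  assume "m \<notin> {..N}"
  then have "sigma_pochhammer \<omega>1 \<omega>2 \<delta> (- of_nat N * \<delta>) m = 0"
    unfolding sigma_pochhammer_def
    by (intro prod_zero bexI[of _ N]) (auto simp: weierstrass_sigma_def)
  then have "(\<Prod>u\<leftarrow>us. sigma_pochhammer \<omega>1 \<omega>2 \<delta> u m
               / sigma_pochhammer \<omega>1 \<omega>2 \<delta> (\<delta> + s - u) m) = 0"
    using assms by (force simp: prod_list_zero_iff)
  then show "weierstrass_sigma \<omega>1 \<omega>2 (s + 2 * of_nat m * \<delta>) / weierstrass_sigma \<omega>1 \<omega>2 s
          * (sigma_pochhammer \<omega>1 \<omega>2 \<delta> s m / sigma_pochhammer \<omega>1 \<omega>2 \<delta> \<delta> m)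
          * (\<Prod>u\<leftarrow>us. sigma_pochhammer \<omega>1 \<omega>2 \<delta> u m
                    / sigma_pochhammer \<omega>1 \<omega>2 \<delta> (\<delta> + s - u) m) = 0"
    by simp
qed simp

end

theory Submission
  imports Defs "HOL-Complex_Analysis.Complex_Analysis"
begin

text \<open>
  Invariance under the exchanges \<open>s\<^sub>k\<close> is the symmetry of the series and of the prefactor in
  \<open>c\<^sub>0, \<dots>, c\<^sub>5\<close>. Invariance under \<open>b\<close> is the elliptic Bailey transformation with
  \<open>\<lambda> = 2s + \<delta> - c\<^sub>0 - c\<^sub>1 - c\<^sub>2\<close> as the new base: the factors of the prefactor that belong to
  \<open>c\<^sub>0, c\<^sub>1, c\<^sub>2\<close> do not change, and the remaining ones are exactly the quotient of the two series.

  Write \<open>[x]\<close> for \<open>\<sigma>(x)\<close>. The transformation rests on two properties: \<open>[x]\<close> is odd, and it satisfies the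
  three-term relation
  \<open>[x+y][x-y][z+w][z-w] + [x+z][x-z][w+y][w-y] + [x+w][x-w][y+z][y-z] = 0\<close>.
  From these two properties one obtains the elliptic analogue of Jackson's sum
  (\<open>jackson_sum_eq\<close>) by induction on the length: the three-term relation splits every summand
  into a summand of length \<open>n - 1\<close> with base \<open>a\<close> and one with base \<open>a + 2\<delta>\<close>, and applied once
  more it shows that the product side obeys the same recursion. As in the classical case, the
  Bailey transformation follows by using Jackson's sum twice. The part of the \<open>m\<close>-th summand
  that involves \<open>c\<^sub>0, c\<^sub>1, c\<^sub>2\<close> is a Jackson sum over \<open>j \<le> m\<close> with base \<open>\<lambda>\<close>
  (\<open>jackson_expansion\<close>); after exchanging the two summations, the sum over \<open>m\<close> is again a Jackson
  sum (\<open>jackson_inner_sum\<close>), and what is left is the series with base \<open>\<lambda>\<close>.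

  Between the two applications a factor \<open>([s - \<lambda>])\<^sub>m\<close> cancels, which may vanish for generic
  parameters. Jackson's sum is therefore stated and proved with its denominators cleared, so that
  this factor never has to be divided by.

  The three-term relation for \<open>\<sigma>\<close> is Liouville's theorem. As a function of \<open>x\<close>, its left-hand
  side \<open>D(x)\<close> has the same quasi-periodicity as \<open>S(x) = [x+z][x-z]\<close> and vanishes at the zeros of
  \<open>S\<close>, which are simple for generic \<open>z\<close>. Hence \<open>D/S\<close> is entire and elliptic, so it is constant,
  and the constant is zero because \<open>D(w) = 0\<close>. The quasi-periodicity enters in the form of
  a relation between four values of \<open>\<sigma>\<close> (\<open>sigma_quasi_period\<close>). This form holds exactly for
  partial products over finite sets of periods that are symmetric about \<open>\<omega>/2\<close>, and passes to the
  limit.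
\<close>

section \<open>The Bailey transformation for odd solutions of the three-term relation\<close>

locale odd_three_term =
  fixes f :: "complex \<Rightarrow> complex" and \<delta> :: complex
  assumes odd: "f (- x) = - f x"
    and three_term: "f (x + y) * f (x - y) * f (z + w) * f (z - w)
      + f (x + z) * f (x - z) * f (w + y) * f (w - y)
      + f (x + w) * f (x - w) * f (y + z) * f (y - z) = 0"
begin

definition poch :: "complex \<Rightarrow> nat \<Rightarrow> complex" where
  "poch x k = (\<Prod>j<k. f (x + of_nat j * \<delta>))"

lemma poch_0 [simp]: "poch x 0 = 1"
  by (simp add: poch_def)

lemma poch_Suc: "poch x (Suc k) = poch x k * f (x + of_nat k * \<delta>)"
  by (simp add: poch_def)

lemma poch_add: "poch x (k + l) = poch x k * poch (x + of_nat k * \<delta>) l"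
  by (induction l) (simp_all add: poch_Suc algebra_simps)

lemma poch_Suc_left: "poch x (Suc k) = f x * poch (x + \<delta>) k"
  using poch_add[of x 1 k] by (simp add: poch_Suc)

lemma poch_split: "k \<le> n \<Longrightarrow> poch x k * poch (x + of_nat k * \<delta>) (n - k) = poch x n"
  using poch_add[of x k "n - k"] by simp

lemma poch_nonzero_iff: "poch x k \<noteq> 0 \<longleftrightarrow> (\<forall>j<k. f (x + of_nat j * \<delta>) \<noteq> 0)"
  by (auto simp: poch_def)

lemma poch_mono_nonzero: "poch x n \<noteq> 0 \<Longrightarrow> k \<le> n \<Longrightarrow> poch x k \<noteq> 0"
  by (auto simp: poch_nonzero_iff)

text \<open>
  By oddness the factors of the two sides are, up to sign, the same ones in opposite order.
\<close>

lemma poch_reflect: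
  assumes "x + y + of_nat k * \<delta> = \<delta>"
  shows "poch x k = (- 1) ^ k * poch y k"
proof -
  have y: "y = \<delta> - x - of_nat k * \<delta>"
    using assms by (simp add: algebra_simps)
  have "poch x k = (\<Prod>j<k. f (x + of_nat (k - Suc j) * \<delta>))"
    unfolding poch_def by (rule prod.nat_diff_reindex [symmetric])
  also have "\<dots> = (\<Prod>j<k. - f (y + of_nat j * \<delta>))"
  proof (rule prod.cong)
    fix j assume "j \<in> {..<k}"
    then have "x + of_nat (k - Suc j) * \<delta> = - (y + of_nat j * \<delta>)"
      by (simp add: y of_nat_diff algebra_simps)
    then show "f (x + of_nat (k - Suc j) * \<delta>) = - f (y + of_nat j * \<delta>)"
      by (simp only: odd)
  qed simp
  also have "\<dots> = (- 1) ^ k * poch y k"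
    by (simp add: prod_uminus poch_def)
  finally show ?thesis .
qed

text \<open>
  The elliptic analogue of the binomial coefficient.
\<close>

definition binom :: "nat \<Rightarrow> nat \<Rightarrow> complex" where
  "binom n k = poch \<delta> n / (poch \<delta> k * poch \<delta> (n - k))"

text \<open>
  The summand of the terminating series with base \<open>a\<close> and parameters \<open>b, c, d, e, -n\<delta>\<close>, multiplied
  by \<open>[a]\<close> and by the common denominator \<open>(a+\<delta>+n\<delta>)\<^sub>n (a+\<delta>-b)\<^sub>n (a+\<delta>-c)\<^sub>n (a+\<delta>-d)\<^sub>n (a+\<delta>-e)\<^sub>n\<close>.
  The sign and the binomial coefficient stand for \<open>(-n\<delta>)\<^sub>k / (\<delta>)\<^sub>k\<close>.
\<close>

definition jackson_term ::
  "nat \<Rightarrow> complex \<Rightarrow> complex \<Rightarrow> complex \<Rightarrow> complex \<Rightarrow> complex \<Rightarrow> nat \<Rightarrow> complex" where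
  "jackson_term n a b c d e k =
     (- 1) ^ k * binom n k * f (a + 2 * of_nat k * \<delta>) * poch a k
     * poch (a + \<delta> + of_nat (n + k) * \<delta>) (n - k)
     * (poch b k * poch (a + \<delta> - b + of_nat k * \<delta>) (n - k))
     * (poch c k * poch (a + \<delta> - c + of_nat k * \<delta>) (n - k))
     * (poch d k * poch (a + \<delta> - d + of_nat k * \<delta>) (n - k))
     * (poch e k * poch (a + \<delta> - e + of_nat k * \<delta>) (n - k))"

text \<open>
  As functions of \<open>k\<close>, the products \<open>[u+k][a-u+k]\<close> for varying \<open>u\<close> span a space of dimension two.
  This is the resulting linear relation for \<open>u = v\<close>, \<open>u = -n\<close> and \<open>u = 0\<close>. For
  very-well-poised summands it amounts to a contiguous relation: \<open>[u+k][a-u+k]\<close> raises the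
  parameter \<open>u\<close>, and the factor \<open>[k][a+k]\<close> shifts the summation index.
\<close>

lemma index_relation:
  "f (v + k) * f (a - v + k) * f n * f (a + n)
     = f (n - k) * f (a + n + k) * f v * f (a - v) + f k * f (a + k) * f (n + v) * f (a + n - v)"
proof -
  have "f (v + k) * f (a - v + k) * f n * f (a + n)
      + f (a + n + k) * f (- (n - k)) * f (- (a - v)) * f (- v)
      + f k * f (a + k) * f (n + v) * f (- (a + n - v)) = 0"
    using three_term[of "a / 2 + k" "v - a / 2" "n + a / 2" "- a / 2"]
    by (simp add: algebra_simps)
  then show ?thesis
    unfolding odd by algebra
qed

text \<open>
  The recursion for the right-hand side of Jackson's sum, after removal of common factors.
\<close>

lemma product_relation:
  assumes "b + c + e + v = 2 * a + n"
  shows "f (a + n - b) * f (a + n - c) * f (a + n - e) * f (a - v) - f b * f c * f e * f (n + v)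
     + f (a + n) * f (a + n - b - c) * f (a - b - v) * f (a - c - v) = 0"
proof -
  have e: "e = 2 * a + n - b - c - v"
    using assms by algebra
  have half: "(b + c) / 2 + (b - c) / 2 = b" "(b + c) / 2 - (b - c) / 2 = c"
    "(e + n + v) / 2 + (e - n - v) / 2 = e" "(e + n + v) / 2 - (e - n - v) / 2 = n + v"
    "(b + c) / 2 + (e + n + v) / 2 = a + n" "(b + c) / 2 - (e + n + v) / 2 = - (a + n - b - c)"
    "(e - n - v) / 2 + (b - c) / 2 = a - c - v" "(e - n - v) / 2 - (b - c) / 2 = a - b - v"
    "(b + c) / 2 + (e - n - v) / 2 = a - v" "(b + c) / 2 - (e - n - v) / 2 = a + n - e"
    "(b - c) / 2 + (e + n + v) / 2 = a + n - c" "(b - c) / 2 - (e + n + v) / 2 = - (a + n - b)"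
    by (simp_all add: e field_simps)
  have "f b * f c * f e * f (n + v) + f (a + n) * f (- (a + n - b - c)) * f (a - c - v) * f (a - b - v)
    + f (a - v) * f (a + n - e) * f (a + n - c) * f (- (a + n - b)) = 0"
    using three_term[of "(b + c) / 2" "(b - c) / 2" "(e + n + v) / 2" "(e - n - v) / 2"]
    unfolding half .
  then show ?thesis
    unfolding odd by algebra
qed

lemma binom_0: "poch \<delta> n \<noteq> 0 \<Longrightarrow> binom n 0 = 1"
  and binom_self: "poch \<delta> n \<noteq> 0 \<Longrightarrow> binom n n = 1"
  by (simp_all add: binom_def)

lemma binom_Suc_left:
  assumes "poch \<delta> (Suc n) \<noteq> 0" "k \<le> n"
  shows "binom (Suc n) k * f (of_nat (Suc n) * \<delta> - of_nat k * \<delta>) = binom n k * f (of_nat (Suc n) * \<delta>)"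
proof -
  have "poch \<delta> k \<noteq> 0" "poch \<delta> (Suc (n - k)) \<noteq> 0"
    by (rule poch_mono_nonzero[OF assms(1)], use assms(2) in simp)+
  moreover have "\<delta> + of_nat (n - k) * \<delta> = of_nat (Suc n) * \<delta> - of_nat k * \<delta>"
    using assms by (simp add: of_nat_diff algebra_simps)
  moreover have "\<delta> + of_nat n * \<delta> = of_nat (Suc n) * \<delta>"
    by (simp add: algebra_simps)
  ultimately show ?thesis
    using assms by (simp add: binom_def Suc_diff_le poch_Suc)
qed

lemma binom_Suc_right:
  assumes "poch \<delta> (Suc n) \<noteq> 0" "k \<le> n"
  shows "binom (Suc n) (Suc k) * f (of_nat (Suc k) * \<delta>) = binom n k * f (of_nat (Suc n) * \<delta>)"
proof -
  have "poch \<delta> (Suc k) \<noteq> 0"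
    by (rule poch_mono_nonzero[OF assms(1)], use assms(2) in simp)+
  moreover have "\<delta> + of_nat k * \<delta> = of_nat (Suc k) * \<delta>" "\<delta> + of_nat n * \<delta> = of_nat (Suc n) * \<delta>"
    by (simp_all add: algebra_simps)
  ultimately show ?thesis
    using assms by (simp add: binom_def poch_Suc)
qed

text \<open>
  The next three lemmas are one contiguous relation, which lowers \<open>n\<close>. At the two ends of the range
  of summation only one of the two terms on its right-hand side is present.
\<close>

lemma jackson_term_first:
  assumes "poch \<delta> (Suc n) \<noteq> 0"
  shows "f (a + of_nat (Suc n) * \<delta>) * jackson_term (Suc n) a b c (v + \<delta>) e 0
    = f (a + of_nat (2 * n + 1) * \<delta>) * f (a + of_nat (2 * n + 2) * \<delta>)
      * f (a + of_nat (Suc n) * \<delta> - b) * f (a + of_nat (Suc n) * \<delta> - c) * f (a + of_nat (Suc n) * \<delta> - e)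
      * f (a - v) * jackson_term n a b c v e 0"
proof -
  define X where "X = poch (a + \<delta> + of_nat n * \<delta>) n"
  define Y where "Y = poch (a + \<delta> + of_nat (Suc n) * \<delta>) (Suc n)"
  have "poch (a + of_nat (Suc n) * \<delta>) (Suc (Suc n)) = f (a + of_nat (Suc n) * \<delta>) * Y"
    unfolding Y_def by (subst poch_Suc_left) (simp add: algebra_simps)
  moreover have "poch (a + of_nat (Suc n) * \<delta>) (Suc (Suc n))
      = X * f (a + of_nat (2 * n + 1) * \<delta>) * f (a + of_nat (2 * n + 2) * \<delta>)"
    unfolding X_def by (simp add: poch_Suc algebra_simps)
  ultimately have XY: "f (a + of_nat (Suc n) * \<delta>) * Y
      = X * f (a + of_nat (2 * n + 1) * \<delta>) * f (a + of_nat (2 * n + 2) * \<delta>)"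
    by simp
  have up: "poch (a + \<delta> - u) (Suc n) = poch (a + \<delta> - u) n * f (a + of_nat (Suc n) * \<delta> - u)" for u
    by (simp add: poch_Suc algebra_simps)
  have v: "poch (a + \<delta> - (v + \<delta>)) (Suc n) = f (a - v) * poch (a + \<delta> - v) n"
    by (subst poch_Suc_left) (simp add: algebra_simps)
  have nz: "poch \<delta> n \<noteq> 0"
    using assms by (rule poch_mono_nonzero) simp
  have "jackson_term (Suc n) a b c (v + \<delta>) e 0 = f a * Y * poch (a + \<delta> - b) (Suc n)
      * poch (a + \<delta> - c) (Suc n) * poch (a + \<delta> - (v + \<delta>)) (Suc n) * poch (a + \<delta> - e) (Suc n)"
    unfolding jackson_term_def Y_def using assms by (simp add: binom_0)
  moreover have "jackson_term n a b c v e 0 = f a * X * poch (a + \<delta> - b) n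
      * poch (a + \<delta> - c) n * poch (a + \<delta> - v) n * poch (a + \<delta> - e) n"
    unfolding jackson_term_def X_def using nz by (simp add: binom_0)
  ultimately show ?thesis
    unfolding v unfolding up using XY by algebra
qed

lemma jackson_term_last:
  assumes "poch \<delta> (Suc n) \<noteq> 0"
  shows "f (a + of_nat (Suc n) * \<delta>) * jackson_term (Suc n) a b c (v + \<delta>) e (Suc n)
    = - (f a * f (a + \<delta>) * f b * f c * f e * f (of_nat (Suc n) * \<delta> + v)
      * jackson_term n (a + 2 * \<delta>) (b + \<delta>) (c + \<delta>) (v + \<delta>) (e + \<delta>) n)"
proof -
  have A: "f (a + of_nat (Suc n) * \<delta>) * poch a (Suc n) = f a * f (a + \<delta>) * poch (a + 2 * \<delta>) n"
  proof -
    have "f (a + of_nat (Suc n) * \<delta>) * poch a (Suc n) = poch a (Suc (Suc n))"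
      by (simp add: poch_Suc)
    also have "\<dots> = f a * f (a + \<delta>) * poch (a + \<delta> + \<delta>) n"
      by (simp only: poch_Suc_left mult.assoc)
    finally show ?thesis
      by (simp add: add.assoc)
  qed
  have up: "poch u (Suc n) = f u * poch (u + \<delta>) n" for u
    by (rule poch_Suc_left)
  have v: "poch (v + \<delta>) (Suc n) = poch (v + \<delta>) n * f (of_nat (Suc n) * \<delta> + v)"
    by (simp add: poch_Suc algebra_simps)
  have nz: "poch \<delta> n \<noteq> 0"
    using assms by (rule poch_mono_nonzero) simp
  define s where "s = (- 1 :: complex) ^ n"
  define g where "g = f (a + 2 * of_nat (Suc n) * \<delta>)"
  have "jackson_term (Suc n) a b c (v + \<delta>) e (Suc n) = - s * g * poch a (Suc n) * poch b (Suc n)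
      * poch c (Suc n) * poch (v + \<delta>) (Suc n) * poch e (Suc n)"
    unfolding jackson_term_def s_def g_def using assms by (simp add: binom_self)
  moreover have "jackson_term n (a + 2 * \<delta>) (b + \<delta>) (c + \<delta>) (v + \<delta>) (e + \<delta>) n
      = s * g * poch (a + 2 * \<delta>) n * poch (b + \<delta>) n
      * poch (c + \<delta>) n * poch (v + \<delta>) n * poch (e + \<delta>) n"
    unfolding jackson_term_def s_def g_def using nz by (simp add: binom_self algebra_simps)
  ultimately show ?thesis
    unfolding up[of b] up[of c] up[of e] v using A by algebra
qed

text \<open>
  The three summands, with their coefficients, share the factors collected in \<open>Z\<close> below. They
  are related by \<open>index_relation\<close>, taken at \<open>n = m\<close>; the factor \<open>[m]\<close> that it introduces is absorbed by the recursion
  of the binomial coefficients.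
\<close>

lemma jackson_term_middle:
  assumes nz: "poch \<delta> (Suc n) \<noteq> 0" and i: "i < n"
  shows "f (a + of_nat (Suc n) * \<delta>) * jackson_term (Suc n) a b c (v + \<delta>) e (Suc i)
    = f (a + of_nat (2 * n + 1) * \<delta>) * f (a + of_nat (2 * n + 2) * \<delta>)
      * f (a + of_nat (Suc n) * \<delta> - b) * f (a + of_nat (Suc n) * \<delta> - c) * f (a + of_nat (Suc n) * \<delta> - e)
      * f (a - v) * jackson_term n a b c v e (Suc i)
     - f a * f (a + \<delta>) * f b * f c * f e * f (of_nat (Suc n) * \<delta> + v)
      * jackson_term n (a + 2 * \<delta>) (b + \<delta>) (c + \<delta>) (v + \<delta>) (e + \<delta>) i"
proof -
  define r where "r = n - Suc i"
  define k where "k = of_nat (Suc i) * \<delta>"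
  define m where "m = of_nat (Suc n) * \<delta>"
  define t where "t = of_nat r * \<delta>"
  have m: "m = k + t + \<delta>"
    using i unfolding m_def k_def t_def r_def by (simp add: of_nat_diff algebra_simps)
  have diffs: "Suc n - Suc i = Suc r" "n - i = Suc r" "n - Suc i = r"
    using i by (simp_all add: r_def)
  have idk: "of_nat i * \<delta> = k - \<delta>" and ndm: "of_nat n * \<delta> = m - \<delta>"
    by (simp_all add: k_def m_def algebra_simps)
  have m2: "a + of_nat (2 * n + 1) * \<delta> = a + 2 * m - \<delta>" "a + of_nat (2 * n + 2) * \<delta> = a + 2 * m"
    by (simp_all add: m_def algebra_simps)
  define X where "X = poch (a + m + k) r"
  define Y where "Y = poch (a + \<delta> + m + k) (Suc r)"
  define s where "s = (- 1 :: complex) ^ i"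
  define g where "g = f (a + 2 * k)"
  define C where "C u = poch (u + \<delta>) i" for u
  define D where "D u = poch (a + \<delta> - u + k) r" for u
  define P where "P = poch a (Suc i)"
  define Q where "Q = poch (a + 2 * \<delta>) i"
  \<comment> \<open>Two evaluations of the shifted factorial of length \<open>r + 2\<close> starting at \<open>a + m + k\<close>.\<close>
  have XY: "f (a + m + k) * Y = X * f (a + 2 * m - \<delta>) * f (a + 2 * m)"
  proof -
    have "poch (a + m + k) (Suc (Suc r)) = f (a + m + k) * Y"
      unfolding Y_def by (subst poch_Suc_left) (simp add: algebra_simps)
    moreover have "poch (a + m + k) (Suc (Suc r)) = X * f (a + m + k + t) * f (a + m + k + t + \<delta>)"
      unfolding X_def t_def by (simp add: poch_Suc algebra_simps)
    moreover have "a + m + k + t = a + 2 * m - \<delta>" "a + m + k + t + \<delta> = a + 2 * m"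
      by (simp_all add: m)
    ultimately show ?thesis by simp
  qed
  have PQ: "P * f (a + k) = f a * f (a + \<delta>) * Q"
  proof -
    have "P * f (a + k) = poch a (Suc (Suc i))"
      by (simp add: poch_Suc P_def k_def)
    also have "\<dots> = f a * f (a + \<delta>) * poch (a + \<delta> + \<delta>) i"
      by (simp only: poch_Suc_left mult.assoc)
    finally show ?thesis
      by (simp add: Q_def add.assoc)
  qed
  have u1: "poch u (Suc i) = f u * C u" for u
    unfolding C_def by (rule poch_Suc_left)
  have u2: "poch (a + \<delta> - u + k) (Suc r) = D u * f (a + m - u)" for u
    unfolding D_def by (simp add: poch_Suc m t_def algebra_simps)
  have u3: "poch (a + 2 * \<delta> + \<delta> - (u + \<delta>) + of_nat i * \<delta>) (Suc r) = D u * f (a + m - u)" for u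
    unfolding u2 [symmetric] idk by (rule arg_cong2[of _ _ _ _ poch]) (simp_all add: algebra_simps)
  have v1: "poch (v + \<delta>) (Suc i) = C v * f (v + k)"
    unfolding C_def by (simp add: poch_Suc k_def algebra_simps)
  have v2: "poch (a + \<delta> - (v + \<delta>) + k) (Suc r) = f (a - v + k) * D v"
    unfolding D_def by (subst poch_Suc_left) (simp add: algebra_simps)
  have y1: "poch (a + \<delta> + of_nat (Suc n + Suc i) * \<delta>) (Suc r) = Y"
    unfolding Y_def by (rule arg_cong2[of _ _ _ _ poch]) (simp_all add: m_def k_def algebra_simps)
  have y2: "poch (a + 2 * \<delta> + \<delta> + of_nat (n + i) * \<delta>) (Suc r) = Y"
    unfolding Y_def by (rule arg_cong2[of _ _ _ _ poch]) (simp_all add: m_def k_def algebra_simps)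
  have x1: "poch (a + \<delta> + of_nat (n + Suc i) * \<delta>) r = X"
    unfolding X_def by (rule arg_cong2[of _ _ _ _ poch]) (simp_all add: m_def k_def algebra_simps)
  have g1: "f (a + 2 * of_nat (Suc i) * \<delta>) = g" "f (a + 2 * \<delta> + 2 * of_nat i * \<delta>) = g"
    unfolding g_def by (simp_all add: k_def algebra_simps)
  define \<beta> where "\<beta> = binom (Suc n) (Suc i)"
  define \<beta>1 where "\<beta>1 = binom n (Suc i)"
  define \<beta>2 where "\<beta>2 = binom n i"
  have F: "jackson_term (Suc n) a b c (v + \<delta>) e (Suc i)
    = - s * \<beta> * g * P * Y * (f b * C b * (D b * f (a + m - b))) * (f c * C c * (D c * f (a + m - c)))
      * (C v * f (v + k) * (f (a - v + k) * D v)) * (f e * C e * (D e * f (a + m - e)))"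
    unfolding jackson_term_def diffs k_def [symmetric] y1 g1 u1[of b] u1[of c] u1[of e] v1 v2 P_def s_def
      \<beta>_def
    unfolding u2 by simp
  have F1: "jackson_term n a b c v e (Suc i)
    = - s * \<beta>1 * g * P * X * (f b * C b * D b) * (f c * C c * D c) * (f v * C v * D v) * (f e * C e * D e)"
    unfolding jackson_term_def diffs k_def [symmetric] x1 g1 u1[of b] u1[of c] u1[of e] u1[of v] 
      D_def [symmetric] P_def s_def \<beta>1_def
    by simp
  have F2: "jackson_term n (a + 2 * \<delta>) (b + \<delta>) (c + \<delta>) (v + \<delta>) (e + \<delta>) i
    = s * \<beta>2 * g * Q * Y * (C b * (D b * f (a + m - b))) * (C c * (D c * f (a + m - c)))
       * (C v * (D v * f (a + m - v))) * (C e * (D e * f (a + m - e)))"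
    unfolding jackson_term_def diffs y2 g1 u3 C_def [symmetric] Q_def s_def \<beta>2_def
    by simp
  have b1: "\<beta> * f (m - k) = \<beta>1 * f m"
    using binom_Suc_left[OF nz, of "Suc i"] i unfolding \<beta>_def \<beta>1_def m_def k_def by simp
  have b2: "\<beta> * f k = \<beta>2 * f m"
    using binom_Suc_right[OF nz, of i] i unfolding \<beta>_def \<beta>2_def m_def k_def by simp
  have m0: "f m \<noteq> 0"
    using nz by (simp add: poch_Suc m_def algebra_simps)
  define Z where "Z = s * g * f b * C b * D b * f c * C c * D c * f e * C e * D e * C v * D v"
  define W where "W = f (a + m - b) * f (a + m - c) * f (a + m - e)"
  have "f m * (f (a + m) * jackson_term (Suc n) a b c (v + \<delta>) e (Suc i))
     = - Z * W * \<beta> * P * Y * (f (v + k) * f (a - v + k) * f m * f (a + m))"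
    unfolding F Z_def W_def by algebra
  also have "\<dots> = - Z * W * P * Y * ((\<beta> * f (m - k)) * f (a + m + k) * f v * f (a - v)
      + (\<beta> * f k) * f (a + k) * f (m + v) * f (a + m - v))"
    unfolding index_relation by algebra
  also have "\<dots> = - Z * W * P * (f (a + m + k) * Y) * \<beta>1 * f m * f v * f (a - v)
      - Z * W * Y * \<beta>2 * f m * (P * f (a + k)) * f (m + v) * f (a + m - v)"
    unfolding b1 b2 by algebra
  also have "\<dots> = f m * (f (a + 2 * m - \<delta>) * f (a + 2 * m) * f (a + m - b) * f (a + m - c) * f (a + m - e)
      * f (a - v) * jackson_term n a b c v e (Suc i)
     - f a * f (a + \<delta>) * f b * f c * f e * f (m + v)
      * jackson_term n (a + 2 * \<delta>) (b + \<delta>) (c + \<delta>) (v + \<delta>) (e + \<delta>) i)"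
    unfolding XY PQ F1 F2 Z_def W_def by algebra
  finally show ?thesis
    unfolding m2 m_def [symmetric] using m0 by simp
qed

definition jackson_sum ::
  "nat \<Rightarrow> complex \<Rightarrow> complex \<Rightarrow> complex \<Rightarrow> complex \<Rightarrow> complex \<Rightarrow> complex" where
  "jackson_sum n a b c d e = (\<Sum>k\<le>n. jackson_term n a b c d e k)"

lemma jackson_sum_Suc:
  assumes nz: "poch \<delta> (Suc n) \<noteq> 0"
  shows "f (a + of_nat (Suc n) * \<delta>) * jackson_sum (Suc n) a b c (v + \<delta>) e
    = f (a + of_nat (2 * n + 1) * \<delta>) * f (a + of_nat (2 * n + 2) * \<delta>)
      * f (a + of_nat (Suc n) * \<delta> - b) * f (a + of_nat (Suc n) * \<delta> - c) * f (a + of_nat (Suc n) * \<delta> - e)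
      * f (a - v) * jackson_sum n a b c v e
     - f a * f (a + \<delta>) * f b * f c * f e * f (of_nat (Suc n) * \<delta> + v)
      * jackson_sum n (a + 2 * \<delta>) (b + \<delta>) (c + \<delta>) (v + \<delta>) (e + \<delta>)"
    (is "?l * _ = ?A * _ - ?B * _")
proof -
  let ?F = "jackson_term (Suc n) a b c (v + \<delta>) e" and ?F1 = "jackson_term n a b c v e"
    and ?F2 = "jackson_term n (a + 2 * \<delta>) (b + \<delta>) (c + \<delta>) (v + \<delta>) (e + \<delta>)"
  have "?l * jackson_sum (Suc n) a b c (v + \<delta>) e
      = ?l * ?F 0 + (\<Sum>i<n. ?l * ?F (Suc i)) + ?l * ?F (Suc n)"
    unfolding jackson_sum_def sum.atMost_Suc_shift
    by (simp add: lessThan_Suc_atMost [symmetric] sum_distrib_left ring_distribs)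
  also have "\<dots> = ?A * ?F1 0 + (\<Sum>i<n. ?A * ?F1 (Suc i) - ?B * ?F2 i) + - (?B * ?F2 n)"
    by (simp only: jackson_term_first[OF nz] jackson_term_last[OF nz])
       (simp add: jackson_term_middle[OF nz] del: of_nat_Suc)
  also have "\<dots> = ?A * (?F1 0 + (\<Sum>i<n. ?F1 (Suc i))) - ?B * ((\<Sum>i<n. ?F2 i) + ?F2 n)"
    by (simp add: sum_subtractf sum_distrib_left [symmetric] ring_distribs)
  also have "?F1 0 + (\<Sum>i<n. ?F1 (Suc i)) = jackson_sum n a b c v e"
    unfolding jackson_sum_def lessThan_Suc_atMost [symmetric] by (rule sum.lessThan_Suc_shift [symmetric])
  also have "(\<Sum>i<n. ?F2 i) + ?F2 n = jackson_sum n (a + 2 * \<delta>) (b + \<delta>) (c + \<delta>) (v + \<delta>) (e + \<delta>)"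
    unfolding jackson_sum_def lessThan_Suc_atMost [symmetric] by simp
  finally show ?thesis .
qed

text \<open>
  The Frenkel-Turaev summation formula (elliptic Jackson sum), with denominators cleared. In the
  recursion \<open>jackson_sum_Suc\<close> both sums of length \<open>n\<close> are again balanced, and their values have the
  common factor \<open>K\<close>; the remaining factors combine by \<open>product_relation\<close>.
\<close>

theorem jackson_sum_eq:
  assumes "poch \<delta> n \<noteq> 0" "poch (a + \<delta>) (2 * n) \<noteq> 0"
    and "b + c + d + e = 2 * a + of_nat (Suc n) * \<delta>"
  shows "jackson_sum n a b c d e
    = (- 1) ^ n * poch a (2 * n + 1) * poch (a + \<delta> - b - c) n * poch (a + \<delta> - b - d) n * poch (a + \<delta> - c - d) n"
  using assms
proof (induction n arbitrary: a b c d e)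
  case 0
  then show ?case
    by (simp add: jackson_sum_def jackson_term_def binom_def poch_def)
next
  case (Suc n)
  note nz = Suc.prems(1) and anz = Suc.prems(2)
  define v where "v = d - \<delta>"
  have d: "d = v + \<delta>"
    by (simp add: v_def)
  define m where "m = of_nat (Suc n) * \<delta>"
  have bal: "b + c + e + v = 2 * a + m"
    using Suc.prems(3) by (simp add: d m_def algebra_simps)
  have nz': "poch \<delta> n \<noteq> 0"
    using nz by (rule poch_mono_nonzero) simp
  have anz': "f (a + \<delta> + of_nat j * \<delta>) \<noteq> 0" if "j < 2 * n + 2" for j
    using anz that by (simp add: poch_nonzero_iff)
  have "f (a + m) \<noteq> 0"
    using anz'[of n] by (simp add: m_def algebra_simps)
  have I1: "jackson_sum n a b c v e = (- 1) ^ n * poch a (2 * n + 1) * poch (a + \<delta> - b - c) n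
       * poch (a + \<delta> - b - v) n * poch (a + \<delta> - c - v) n"
  proof (rule Suc.IH[OF nz'])
    show "poch (a + \<delta>) (2 * n) \<noteq> 0"
      using anz by (rule poch_mono_nonzero) simp
    show "b + c + v + e = 2 * a + of_nat (Suc n) * \<delta>"
      using bal by (simp add: m_def algebra_simps)
  qed
  have I2: "jackson_sum n (a + 2 * \<delta>) (b + \<delta>) (c + \<delta>) (v + \<delta>) (e + \<delta>)
      = (- 1) ^ n * poch (a + 2 * \<delta>) (2 * n + 1) * poch (a + 2 * \<delta> + \<delta> - (b + \<delta>) - (c + \<delta>)) n
       * poch (a + 2 * \<delta> + \<delta> - (b + \<delta>) - (v + \<delta>)) n * poch (a + 2 * \<delta> + \<delta> - (c + \<delta>) - (v + \<delta>)) n"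
  proof (rule Suc.IH[OF nz'])
    show "poch (a + 2 * \<delta> + \<delta>) (2 * n) \<noteq> 0"
      unfolding poch_nonzero_iff using anz'[of "_ + 2"] by (simp add: algebra_simps)
    show "b + \<delta> + (c + \<delta>) + (v + \<delta>) + (e + \<delta>) = 2 * (a + 2 * \<delta>) + of_nat (Suc n) * \<delta>"
      using bal by (simp add: m_def algebra_simps)
  qed
  have shift: "a + 2 * \<delta> + \<delta> - (x + \<delta>) - (y + \<delta>) = a + \<delta> - x - y" for x y
    by simp
  define K where "K = poch (a + \<delta> - b - c) n * poch (a + \<delta> - b - v) n * poch (a + \<delta> - c - v) n"
  define M where "M = poch (a + \<delta> + \<delta>) (2 * n + 1)"
  have A2: "f (a + \<delta>) * f a * M = poch a (2 * n + 3)"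
  proof -
    have "2 * n + 3 = Suc (Suc (2 * n + 1))" by simp
    then have "poch a (2 * n + 3) = f a * (f (a + \<delta>) * M)"
      unfolding M_def by (simp only: poch_Suc_left)
    then show ?thesis by algebra
  qed
  have A1: "poch a (2 * n + 1) * f (a + of_nat (2 * n + 1) * \<delta>) * f (a + of_nat (2 * n + 2) * \<delta>)
      = poch a (2 * n + 3)"
  proof -
    have "2 * n + 3 = Suc (Suc (2 * n + 1))" "2 * n + 2 = Suc (2 * n + 1)" by simp_all
    then show ?thesis
      by (simp only: poch_Suc)
  qed
  have p1: "poch (a + \<delta> - b - c) (Suc n) = poch (a + \<delta> - b - c) n * f (a + m - b - c)"
    by (simp add: poch_Suc m_def algebra_simps)
  have p2: "poch (a + \<delta> - x - d) (Suc n) = f (a - x - v) * poch (a + \<delta> - x - v) n" for x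
    unfolding d by (subst poch_Suc_left) (simp add: algebra_simps)
  have "f (a + m) * jackson_sum (Suc n) a b c d e
      = (poch a (2 * n + 1) * f (a + of_nat (2 * n + 1) * \<delta>) * f (a + of_nat (2 * n + 2) * \<delta>))
        * (- 1) ^ n * K * (f (a + m - b) * f (a + m - c) * f (a + m - e) * f (a - v))
      - (f (a + \<delta>) * f a * M) * (- 1) ^ n * K * (f b * f c * f e * f (m + v))"
    unfolding d m_def jackson_sum_Suc[OF nz] I1 I2 shift K_def M_def
    by (simp add: algebra_simps)
  also have "\<dots> = poch a (2 * n + 3) * (- 1) ^ n * K *
      (f (a + m - b) * f (a + m - c) * f (a + m - e) * f (a - v) - f b * f c * f e * f (m + v))"
    unfolding A1 A2 by algebra
  also have "f (a + m - b) * f (a + m - c) * f (a + m - e) * f (a - v) - f b * f c * f e * f (m + v)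
      = - (f (a + m) * f (a + m - b - c) * f (a - b - v) * f (a - c - v))"
    using product_relation[OF bal] by algebra
  also have "poch a (2 * n + 3) * (- 1) ^ n * K *
        - (f (a + m) * f (a + m - b - c) * f (a - b - v) * f (a - c - v))
     = f (a + m) * ((- 1) ^ Suc n * poch a (2 * n + 3) * poch (a + \<delta> - b - c) (Suc n)
        * poch (a + \<delta> - b - d) (Suc n) * poch (a + \<delta> - c - d) (Suc n))"
    unfolding p1 p2 K_def by simp
  finally have "jackson_sum (Suc n) a b c d e = (- 1) ^ Suc n * poch a (2 * n + 3)
      * poch (a + \<delta> - b - c) (Suc n) * poch (a + \<delta> - b - d) (Suc n) * poch (a + \<delta> - c - d) (Suc n)"
    using \<open>f (a + m) \<noteq> 0\<close> mult_left_cancel by blast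
  moreover have "2 * n + 3 = 2 * Suc n + 1"
    by simp
  ultimately show ?case
    by (simp only:)
qed

text \<open>
  Jackson's sum for the base \<open>l\<close>, read from right to left: it trades the parameters \<open>b, c, d\<close> over
  the base \<open>a\<close> for the parameters \<open>l + b - a\<close>, \<open>l + c - a\<close>, \<open>l + d - a\<close> over the base \<open>l\<close>. The fourth
  parameter \<open>a + m\<delta>\<close> has the partner \<open>l + \<delta> - a - m\<delta>\<close>, whose remaining factors are, up to sign,
  the numerator \<open>(a-l)\<^bsub>m-j\<^esub>\<close>.
\<close>

lemma jackson_expansion:
  assumes nz: "poch \<delta> m \<noteq> 0" and lnz: "poch (l + \<delta>) (2 * m) \<noteq> 0"
    and anz: "\<forall>x\<in>{b, c, d}. poch (a + \<delta> - x) m \<noteq> 0"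
    and l: "l = 2 * a + \<delta> - b - c - d"
  shows "f l * (poch b m / poch (a + \<delta> - b) m * (poch c m / poch (a + \<delta> - c) m)
        * (poch d m / poch (a + \<delta> - d) m))
    = (\<Sum>j\<le>m. binom m j * f (l + 2 * of_nat j * \<delta>) * poch l j / poch (l + \<delta>) (m + j)
        * (poch (l + b - a) j / poch (a + \<delta> - b) j * (poch (l + c - a) j / poch (a + \<delta> - c) j)
          * (poch (l + d - a) j / poch (a + \<delta> - d) j))
        * poch (a + of_nat m * \<delta>) j * poch (a - l) (m - j))"
    (is "_ = (\<Sum>j\<le>m. ?t j)")
proof -
  define C where "C = (- 1) ^ m * poch (l + \<delta>) (2 * m)
    * (poch (a + \<delta> - b) m * poch (a + \<delta> - c) m * poch (a + \<delta> - d) m)"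
  have "C \<noteq> 0"
    using lnz anz by (simp add: C_def)
  have cleared: "jackson_term m l (l + b - a) (l + c - a) (l + d - a) (a + of_nat m * \<delta>) j = C * ?t j"
    if "j \<le> m" for j
  proof -
    have s: "l + \<delta> - (l + x - a) = a + \<delta> - x" for x
      by simp
    have r: "poch (a + \<delta> - x + of_nat j * \<delta>) (m - j) = poch (a + \<delta> - x) m / poch (a + \<delta> - x) j"
      if "x \<in> {b, c, d}" for x
      using poch_split[OF \<open>j \<le> m\<close>, of "a + \<delta> - x"] poch_mono_nonzero[OF bspec[OF anz that] \<open>j \<le> m\<close>]
      by (simp add: field_simps)
    have rl: "poch (l + \<delta> + of_nat (m + j) * \<delta>) (m - j) = poch (l + \<delta>) (2 * m) / poch (l + \<delta>) (m + j)"
    proof -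
      have "m + j \<le> 2 * m" "2 * m - (m + j) = m - j"
        using \<open>j \<le> m\<close> by auto
      then show ?thesis
        using poch_split[of "m + j" "2 * m" "l + \<delta>"] poch_mono_nonzero[OF lnz, of "m + j"]
        by (simp only:) (simp add: field_simps)
    qed
    have re: "poch (l + \<delta> - (a + of_nat m * \<delta>) + of_nat j * \<delta>) (m - j) = (- 1) ^ (m - j) * poch (a - l) (m - j)"
      by (rule poch_reflect) (simp add: of_nat_diff \<open>j \<le> m\<close> algebra_simps)
    have sg: "(- 1) ^ j * (- 1) ^ (m - j) = (- 1 :: complex) ^ m"
      using \<open>j \<le> m\<close> by (simp flip: power_add)
    show ?thesis
      unfolding jackson_term_def s re rl r[of b, simplified] r[of c, simplified] r[of d, simplified] C_def
        sg [symmetric]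
      by (simp add: divide_inverse mult_ac)
  qed
  have "C * (\<Sum>j\<le>m. ?t j) = jackson_sum m l (l + b - a) (l + c - a) (l + d - a) (a + of_nat m * \<delta>)"
    unfolding jackson_sum_def sum_distrib_left by (rule sum.cong) (simp_all add: cleared)
  also have "\<dots> = (- 1) ^ m * poch l (2 * m + 1) * poch (l + \<delta> - (l + b - a) - (l + c - a)) m
      * poch (l + \<delta> - (l + b - a) - (l + d - a)) m * poch (l + \<delta> - (l + c - a) - (l + d - a)) m"
    by (rule jackson_sum_eq[OF nz lnz]) (simp add: l algebra_simps)
  also have "l + \<delta> - (l + b - a) - (l + c - a) = d" 
    by (simp add: l algebra_simps)
  also have "l + \<delta> - (l + b - a) - (l + d - a) = c" 
    by (simp add: l algebra_simps)
  also have "l + \<delta> - (l + c - a) - (l + d - a) = b" 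
    by (simp add: l algebra_simps)
  also have "(- 1) ^ m * poch l (2 * m + 1) * poch d m * poch c m * poch b m
     = C * (f l * (poch b m / poch (a + \<delta> - b) m * (poch c m / poch (a + \<delta> - c) m)
        * (poch d m / poch (a + \<delta> - d) m)))"
    using anz by (simp add: C_def poch_Suc_left)
  finally show ?thesis
    by (rule mult_left_cancel[OF \<open>C \<noteq> 0\<close>, THEN iffD1, THEN sym])
qed

text \<open>
  With \<open>m = j + i\<close>, this is Jackson's sum of length \<open>N - j\<close> for the base \<open>a + 2j\<delta>\<close> and the parameters
  \<open>e + j\<delta>\<close>, \<open>g + j\<delta>\<close>, \<open>h + j\<delta>\<close> and \<open>a - l\<close>. The last one makes the sum balanced because of the
  balancing condition on \<open>e + g + h\<close>.
\<close>

lemma jackson_inner_sum: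
  assumes nz: "poch \<delta> N \<noteq> 0" and "f a \<noteq> 0"
    and anz: "poch (a + \<delta>) (2 * N) \<noteq> 0" and lnz: "poch (l + \<delta>) (2 * N) \<noteq> 0"
    and xnz: "\<forall>x\<in>{e, g, h}. poch (a + \<delta> - x) N \<noteq> 0 \<and> poch (l + \<delta> - x) N \<noteq> 0"
    and bal: "e + g + h = a + l + of_nat (Suc N) * \<delta>"
    and j: "j \<le> N"
    and W: "\<And>m. W m = poch e m / poch (a + \<delta> - e) m * (poch g m / poch (a + \<delta> - g) m)
        * (poch h m / poch (a + \<delta> - h) m)
        * (poch (- of_nat N * \<delta>) m / poch (a + \<delta> + of_nat N * \<delta>) m)"
  shows "(\<Sum>i\<le>N - j. f (a + 2 * of_nat (j + i) * \<delta>) * poch a (2 * j + i) * poch (a - l) i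
          / (poch \<delta> i * poch (l + \<delta>) (2 * j + i)) * W (j + i))
    = f a * (poch (a + \<delta>) N / poch (l + \<delta>) N
        * (poch (l + \<delta> - e) N / poch (a + \<delta> - e) N * (poch (l + \<delta> - g) N / poch (a + \<delta> - g) N)
          * (poch (l + \<delta> - h) N / poch (a + \<delta> - h) N)))
      * (poch e j / poch (l + \<delta> - e) j * (poch g j / poch (l + \<delta> - g) j) * (poch h j / poch (l + \<delta> - h) j)
        * (poch (- of_nat N * \<delta>) j / poch (l + \<delta> + of_nat N * \<delta>) j))"
    (is "(\<Sum>i\<le>_. ?t i) = ?R")
proof -
  define n where "n = N - j"
  define A where "A = a + 2 * of_nat j * \<delta>"
  define D where "D = poch (l + \<delta>) (N + j) * (poch (a + \<delta> - e) N * poch (a + \<delta> - g) N * poch (a + \<delta> - h) N)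
     * poch (a + \<delta> + of_nat N * \<delta>) N"
  define M where "M = poch a (2 * j) * (poch e j * poch g j * poch h j) * poch (- of_nat N * \<delta>) j"
  have N: "of_nat N * \<delta> = of_nat j * \<delta> + of_nat n * \<delta>"
  proof -
    have "N = j + n"
      using j by (simp add: n_def)
    then show ?thesis
      by (simp add: distrib_right)
  qed
  have aN: "poch (a + \<delta>) (2 * N) = poch (a + \<delta>) N * poch (a + \<delta> + of_nat N * \<delta>) N"
    by (simp add: mult_2 poch_add)
  have lNj: "poch (l + \<delta>) (N + j) = poch (l + \<delta>) N * poch (l + \<delta> + of_nat N * \<delta>) j"
    by (rule poch_add)
  have lNj0: "poch (l + \<delta>) (N + j) \<noteq> 0"
    by (rule poch_mono_nonzero[OF lnz]) (use j in simp)
  have a0: "poch (a + \<delta> + of_nat N * \<delta>) N \<noteq> 0" "poch (a + \<delta>) N \<noteq> 0"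
    using anz unfolding aN by auto
  have "D \<noteq> 0"
    using xnz lNj0 a0 by (simp add: D_def)
  have n0: "poch \<delta> n \<noteq> 0"
    by (rule poch_mono_nonzero[OF nz]) (simp add: n_def)
  have cleared: "?t i * D = M * jackson_term n A (e + of_nat j * \<delta>) (g + of_nat j * \<delta>) (h + of_nat j * \<delta>) (a - l) i"
    if i: "i \<le> n" for i
  proof -
    have ji: "j + i \<le> N" "N - (j + i) = n - i"
      using i j by (auto simp: n_def)
    have x1: "poch x j * poch (x + of_nat j * \<delta>) i = poch x (j + i)" for x
      by (simp add: poch_add)
    have x2: "poch (A + \<delta> - (x + of_nat j * \<delta>) + of_nat i * \<delta>) (n - i) = poch (a + \<delta> - x) N / poch (a + \<delta> - x) (j + i)"
      if "x \<in> {e, g, h}" for x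
    proof -
      have "A + \<delta> - (x + of_nat j * \<delta>) + of_nat i * \<delta> = a + \<delta> - x + of_nat (j + i) * \<delta>"
        by (simp add: A_def algebra_simps)
      moreover have "poch (a + \<delta> - x) (j + i) \<noteq> 0"
        using poch_mono_nonzero[OF conjunct1[OF bspec[OF xnz that]] ji(1)] .
      ultimately show ?thesis
        using poch_split[OF ji(1), of "a + \<delta> - x"] ji(2) by (simp only:) (simp add: field_simps)
    qed
    have x3: "poch (A + \<delta> + of_nat (n + i) * \<delta>) (n - i)
       = poch (a + \<delta> + of_nat N * \<delta>) N / poch (a + \<delta> + of_nat N * \<delta>) (j + i)"
    proof -
      have "A + \<delta> + of_nat (n + i) * \<delta> = a + \<delta> + of_nat N * \<delta> + of_nat (j + i) * \<delta>"
        using N by (simp add: A_def algebra_simps)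
      moreover have "poch (a + \<delta> + of_nat N * \<delta>) (j + i) \<noteq> 0"
        using poch_mono_nonzero[OF a0(1) ji(1)] .
      ultimately show ?thesis
        using poch_split[OF ji(1), of "a + \<delta> + of_nat N * \<delta>"] ji(2) by (simp only:) (simp add: field_simps)
    qed
    have x4: "poch (A + \<delta> - (a - l) + of_nat i * \<delta>) (n - i) = poch (l + \<delta>) (N + j) / poch (l + \<delta>) (2 * j + i)"
    proof -
      have "A + \<delta> - (a - l) + of_nat i * \<delta> = l + \<delta> + of_nat (2 * j + i) * \<delta>"
        by (simp add: A_def algebra_simps)
      moreover have k: "2 * j + i \<le> N + j" "N + j - (2 * j + i) = n - i"
        using i j by (auto simp: n_def)
      moreover have "poch (l + \<delta>) (2 * j + i) \<noteq> 0"
        by (rule poch_mono_nonzero[OF lNj0 k(1)])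
      ultimately show ?thesis
        using poch_split[OF k(1), of "l + \<delta>"] by (simp only:) (simp add: field_simps)
    qed
    have x5: "poch a (2 * j) * poch A i = poch a (2 * j + i)"
      by (simp add: poch_add A_def)
    have x6: "poch (- of_nat N * \<delta>) j * ((- 1) ^ i * binom n i) = poch (- of_nat N * \<delta>) (j + i) / poch \<delta> i"
    proof -
      have "poch (- of_nat N * \<delta> + of_nat j * \<delta>) i = (- 1) ^ i * poch (\<delta> + of_nat (n - i) * \<delta>) i"
        by (rule poch_reflect) (use i N in \<open>simp add: of_nat_diff algebra_simps\<close>)
      moreover have "poch \<delta> n = poch \<delta> (n - i) * poch (\<delta> + of_nat (n - i) * \<delta>) i"
        using poch_split[of "n - i" n \<delta>] i by simp
      moreover have "poch \<delta> (n - i) \<noteq> 0"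
        by (rule poch_mono_nonzero[OF n0]) simp
      ultimately show ?thesis
        unfolding poch_add[of _ j i] binom_def by simp
    qed
    have x7: "f (a + 2 * of_nat (j + i) * \<delta>) = f (A + 2 * of_nat i * \<delta>)"
      by (simp add: A_def algebra_simps)
    have "M * jackson_term n A (e + of_nat j * \<delta>) (g + of_nat j * \<delta>) (h + of_nat j * \<delta>) (a - l) i
      = (poch (- of_nat N * \<delta>) j * ((- 1) ^ i * binom n i)) * f (A + 2 * of_nat i * \<delta>)
       * (poch a (2 * j) * poch A i) * poch (A + \<delta> + of_nat (n + i) * \<delta>) (n - i)
       * ((poch e j * poch (e + of_nat j * \<delta>) i) * poch (A + \<delta> - (e + of_nat j * \<delta>) + of_nat i * \<delta>) (n - i))
       * ((poch g j * poch (g + of_nat j * \<delta>) i) * poch (A + \<delta> - (g + of_nat j * \<delta>) + of_nat i * \<delta>) (n - i))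
       * ((poch h j * poch (h + of_nat j * \<delta>) i) * poch (A + \<delta> - (h + of_nat j * \<delta>) + of_nat i * \<delta>) (n - i))
       * (poch (a - l) i * poch (A + \<delta> - (a - l) + of_nat i * \<delta>) (n - i))"
      unfolding jackson_term_def M_def by (simp only: mult_ac)
    also have "\<dots> = ?t i * D"
      unfolding x1 x2[of e, simplified] x2[of g, simplified] x2[of h, simplified] x3 x4 x5 x6 x7 D_def W
      by simp (simp add: divide_inverse mult_ac)
    finally show ?thesis ..
  qed
  have reflected: "poch (A + \<delta> - (x + of_nat j * \<delta>) - (y + of_nat j * \<delta>)) n
      = (- 1) ^ n * (poch (l + \<delta> - z) N / poch (l + \<delta> - z) j)"
    if "x + y + z = e + g + h" "z \<in> {e, g, h}" for x y z
  proof -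
    have "z = a + l + of_nat (Suc N) * \<delta> - x - y"
      using that(1) bal by (simp add: algebra_simps)
    then have "poch (A + \<delta> - (x + of_nat j * \<delta>) - (y + of_nat j * \<delta>)) n
        = (- 1) ^ n * poch (l + \<delta> - z + of_nat j * \<delta>) n"
      using N by (intro poch_reflect) (simp add: A_def algebra_simps)
    moreover have "poch (l + \<delta> - z) j \<noteq> 0"
      using poch_mono_nonzero[OF conjunct2[OF bspec[OF xnz that(2)]] j] .
    ultimately show ?thesis
      using poch_split[OF j, of "l + \<delta> - z"] by (simp add: n_def field_simps)
  qed
  have a2N: "poch a (2 * j) * poch A (2 * n + 1) = f a * (poch (a + \<delta>) N * poch (a + \<delta> + of_nat N * \<delta>) N)"
  proof -
    have "2 * N + 1 = 2 * j + (2 * n + 1)"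
      using j by (simp add: n_def)
    then have "poch a (2 * N + 1) = poch a (2 * j) * poch A (2 * n + 1)"
      unfolding A_def by (simp only: poch_add) simp
    then show ?thesis
      by (simp add: poch_Suc_left aN)
  qed
  have sg: "(- 1 :: complex) ^ n * (- 1) ^ n = 1"
    by (simp flip: power_add mult_2)
  define L where "L z = poch (l + \<delta> - z) N / poch (l + \<delta> - z) j" for z
  have "(\<Sum>i\<le>n. ?t i) * D = M * jackson_sum n A (e + of_nat j * \<delta>) (g + of_nat j * \<delta>) (h + of_nat j * \<delta>) (a - l)"
    unfolding jackson_sum_def sum_distrib_left sum_distrib_right
    by (rule sum.cong[OF refl], rule cleared) simp
  also have "jackson_sum n A (e + of_nat j * \<delta>) (g + of_nat j * \<delta>) (h + of_nat j * \<delta>) (a - l)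
    = (- 1) ^ n * poch A (2 * n + 1) * poch (A + \<delta> - (e + of_nat j * \<delta>) - (g + of_nat j * \<delta>)) n
      * poch (A + \<delta> - (e + of_nat j * \<delta>) - (h + of_nat j * \<delta>)) n
      * poch (A + \<delta> - (g + of_nat j * \<delta>) - (h + of_nat j * \<delta>)) n"
  proof (rule jackson_sum_eq[OF n0])
    show "poch (A + \<delta>) (2 * n) \<noteq> 0"
    proof -
      have "2 * N = 2 * j + 2 * n" 
        using j by (simp add: n_def)
      then have "poch (a + \<delta>) (2 * N) = poch (a + \<delta>) (2 * j) * poch (a + \<delta> + of_nat (2 * j) * \<delta>) (2 * n)"
        by (simp only: poch_add)
      moreover have "a + \<delta> + of_nat (2 * j) * \<delta> = A + \<delta>"
        by (simp add: A_def)
      ultimately have "poch (a + \<delta>) (2 * N) = poch (a + \<delta>) (2 * j) * poch (A + \<delta>) (2 * n)"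
        by (simp only:)
      then show ?thesis
        using anz by auto
    qed
    have "e = a + l + of_nat (Suc N) * \<delta> - g - h"
      using bal by (simp add: algebra_simps)
    then show "e + of_nat j * \<delta> + (g + of_nat j * \<delta>) + (h + of_nat j * \<delta>) + (a - l) = 2 * A + of_nat (Suc n) * \<delta>"
      using N by (simp add: A_def algebra_simps)
  qed
  also have "\<dots> = (- 1) ^ n * poch A (2 * n + 1) * ((- 1) ^ n * L h) * ((- 1) ^ n * L g) * ((- 1) ^ n * L e)"
  proof -
    have "poch (A + \<delta> - (e + of_nat j * \<delta>) - (g + of_nat j * \<delta>)) n = (- 1) ^ n * L h"
      unfolding L_def by (rule reflected) simp_all
    moreover have "poch (A + \<delta> - (e + of_nat j * \<delta>) - (h + of_nat j * \<delta>)) n = (- 1) ^ n * L g"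
      unfolding L_def by (rule reflected) simp_all
    moreover have "poch (A + \<delta> - (g + of_nat j * \<delta>) - (h + of_nat j * \<delta>)) n = (- 1) ^ n * L e"
      unfolding L_def by (rule reflected) simp_all
    ultimately show ?thesis
      by (simp only:)
  qed
  also have "\<dots> = ((- 1) ^ n * (- 1) ^ n) * ((- 1) ^ n * (- 1) ^ n) * poch A (2 * n + 1) * (L h * L g * L e)"
    by (simp only: mult_ac)
  also have "M * \<dots> = poch a (2 * j) * poch A (2 * n + 1) * (poch e j * poch g j * poch h j)
      * poch (- of_nat N * \<delta>) j * (L h * L g * L e)"
    unfolding sg M_def by simp
  also have "\<dots> = ?R * D"
    unfolding a2N D_def L_def lNj using xnz a0 lNj0[unfolded lNj]
    by simp (simp add: divide_inverse mult_ac)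
  finally show ?thesis
    unfolding n_def [symmetric] by (rule mult_right_cancel[OF \<open>D \<noteq> 0\<close>, THEN iffD1])
qed

definition very_well_poised_term :: "complex \<Rightarrow> complex list \<Rightarrow> nat \<Rightarrow> complex" where
  "very_well_poised_term a us m = f (a + 2 * of_nat m * \<delta>) / f a * (poch a m / poch \<delta> m)
     * (\<Prod>u\<leftarrow>us. poch u m / poch (\<delta> + a - u) m)"

text \<open>
  The elliptic Bailey transformation. Up to the factor \<open>[a][l]\<close>, both sides are evaluations of
  the same double sum \<open>\<Sum> R j * t j i\<close> over \<open>j + i \<le> N\<close>: summation over \<open>j\<close> for fixed \<open>m = j + i\<close> gives the left-hand side
  by \<open>jackson_expansion\<close>, and summation over \<open>i\<close> for fixed \<open>j\<close> gives the right-hand side by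
  \<open>jackson_inner_sum\<close>.
\<close>

theorem bailey_transformation:
  assumes nz: "poch \<delta> N \<noteq> 0" and a0: "f a \<noteq> 0" and l0: "f l \<noteq> 0"
    and anz: "poch (a + \<delta>) (2 * N) \<noteq> 0" and lnz: "poch (l + \<delta>) (2 * N) \<noteq> 0"
    and bnz: "\<forall>x\<in>{b, c, d}. poch (a + \<delta> - x) N \<noteq> 0"
    and enz: "\<forall>x\<in>{e, g, h}. poch (a + \<delta> - x) N \<noteq> 0 \<and> poch (l + \<delta> - x) N \<noteq> 0"
    and l: "l = 2 * a + \<delta> - b - c - d"
    and bal: "e + g + h = a + l + of_nat (Suc N) * \<delta>"
  shows "(\<Sum>m\<le>N. very_well_poised_term a [b, c, d, e, g, h, - of_nat N * \<delta>] m)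
    = poch (a + \<delta>) N / poch (l + \<delta>) N
        * (poch (l + \<delta> - e) N / poch (a + \<delta> - e) N * (poch (l + \<delta> - g) N / poch (a + \<delta> - g) N)
          * (poch (l + \<delta> - h) N / poch (a + \<delta> - h) N))
      * (\<Sum>m\<le>N. very_well_poised_term l [l + b - a, l + c - a, l + d - a, e, g, h, - of_nat N * \<delta>] m)"
    (is "_ = ?K * _")
proof -
  define W where "W m = poch e m / poch (a + \<delta> - e) m * (poch g m / poch (a + \<delta> - g) m)
        * (poch h m / poch (a + \<delta> - h) m)
        * (poch (- of_nat N * \<delta>) m / poch (a + \<delta> + of_nat N * \<delta>) m)" for m
  define R where "R j = f (l + 2 * of_nat j * \<delta>) * (poch l j / poch \<delta> j)
        * (poch (l + b - a) j / poch (a + \<delta> - b) j * (poch (l + c - a) j / poch (a + \<delta> - c) j)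
          * (poch (l + d - a) j / poch (a + \<delta> - d) j))" for j
  define t where "t j i = f (a + 2 * of_nat (j + i) * \<delta>) * poch a (2 * j + i) * poch (a - l) i
          / (poch \<delta> i * poch (l + \<delta>) (2 * j + i)) * W (j + i)" for j i
  have sw: "\<delta> + x - y = x + \<delta> - y" "x + \<delta> - (- of_nat N * \<delta>) = x + \<delta> + of_nat N * \<delta>" for x y
    by simp_all
  have outer: "f a * f l * very_well_poised_term a [b, c, d, e, g, h, - of_nat N * \<delta>] m = (\<Sum>j\<le>m. R j * t j (m - j))"
    if "m \<le> N" for m
  proof -
    have m0: "poch \<delta> m \<noteq> 0" "poch (l + \<delta>) (2 * m) \<noteq> 0"
      by (rule poch_mono_nonzero[OF nz that], rule poch_mono_nonzero[OF lnz], use that in simp)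
    have bm0: "\<forall>x\<in>{b, c, d}. poch (a + \<delta> - x) m \<noteq> 0"
      using bnz poch_mono_nonzero[OF _ that] by blast
    have "f a * f l * very_well_poised_term a [b, c, d, e, g, h, - of_nat N * \<delta>] m
       = f (a + 2 * of_nat m * \<delta>) * poch a m / poch \<delta> m * W m
        * (f l * (poch b m / poch (a + \<delta> - b) m * (poch c m / poch (a + \<delta> - c) m)
        * (poch d m / poch (a + \<delta> - d) m)))"
      unfolding very_well_poised_term_def W_def sw using a0 by (simp add: sw mult_ac)
    also have "\<dots> = (\<Sum>j\<le>m. R j * t j (m - j))"
      unfolding jackson_expansion[OF m0 bm0 l] sum_distrib_left
    proof (rule sum.cong)
      fix j assume "j \<in> {..m}"
      then have j: "j \<le> m" by simp
      have e: "j + (m - j) = m" "2 * j + (m - j) = m + j"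
        using j by auto
      have am: "poch a (m + j) = poch a m * poch (a + of_nat m * \<delta>) j"
        by (rule poch_add)
      show "f (a + 2 * of_nat m * \<delta>) * poch a m / poch \<delta> m * W m *
         (binom m j * f (l + 2 * of_nat j * \<delta>) * poch l j / poch (l + \<delta>) (m + j)
        * (poch (l + b - a) j / poch (a + \<delta> - b) j * (poch (l + c - a) j / poch (a + \<delta> - c) j)
          * (poch (l + d - a) j / poch (a + \<delta> - d) j))
        * poch (a + of_nat m * \<delta>) j * poch (a - l) (m - j)) = R j * t j (m - j)"
        unfolding R_def t_def e am binom_def using m0 by simp (simp add: divide_inverse mult_ac)
    qed simp
    finally show ?thesis .
  qed
  have "f a * f l * (\<Sum>m\<le>N. very_well_poised_term a [b, c, d, e, g, h, - of_nat N * \<delta>] m)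
     = (\<Sum>m\<le>N. \<Sum>j\<le>m. R j * t j (m - j))"
    unfolding sum_distrib_left using outer by (intro sum.cong) (simp_all only: atMost_iff)
  also have "\<dots> = (\<Sum>(j, i)\<in>{(j, i). j + i \<le> N}. R j * t j i)"
    by (rule sum.triangle_reindex_eq [symmetric])
  also have "{(j, i). j + i \<le> N} = Sigma {..N} (\<lambda>j. {..N - j})"
    by auto
  also have "(\<Sum>(j, i)\<in>Sigma {..N} (\<lambda>j. {..N - j}). R j * t j i) = (\<Sum>j\<le>N. \<Sum>i\<le>N - j. R j * t j i)"
    by (rule sum.Sigma [symmetric]) auto
  also have "\<dots> = (\<Sum>j\<le>N. f a * f l * (?K * very_well_poised_term l [l + b - a, l + c - a, l + d - a, e, g, h, - of_nat N * \<delta>] j))"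
  proof (rule sum.cong)
    fix j assume "j \<in> {..N}"
    then have j: "j \<le> N" by simp
    have lx: "l + \<delta> - (l + x - a) = a + \<delta> - x" for x
      by simp
    show "(\<Sum>i\<le>N - j. R j * t j i)
        = f a * f l * (?K * very_well_poised_term l [l + b - a, l + c - a, l + d - a, e, g, h, - of_nat N * \<delta>] j)"
      unfolding sum_distrib_left [symmetric] t_def
        jackson_inner_sum[OF nz a0 anz lnz enz bal j W_def]
      unfolding very_well_poised_term_def R_def using l0 by (simp add: sw lx mult_ac)
  qed simp
  also have "\<dots> = f a * f l * (?K * (\<Sum>m\<le>N. very_well_poised_term l [l + b - a, l + c - a, l + d - a, e, g, h, - of_nat N * \<delta>] m))"
    by (simp only: sum_distrib_left)
  finally show ?thesis
    by (rule mult_left_cancel[THEN iffD1, rotated]) (use a0 l0 in simp)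
qed

end

section \<open>The period lattice\<close>

lemma zero_in_period_lattice [simp]: "0 \<in> period_lattice \<omega>1 \<omega>2"
  unfolding period_lattice_def by (auto intro!: exI[of _ 0])

lemma period_lattice_add:
  assumes "x \<in> period_lattice \<omega>1 \<omega>2" "y \<in> period_lattice \<omega>1 \<omega>2"
  shows "x + y \<in> period_lattice \<omega>1 \<omega>2"
proof -
  obtain m n m' n' where "x = of_int m * \<omega>1 + of_int n * \<omega>2" "y = of_int m' * \<omega>1 + of_int n' * \<omega>2"
    using assms unfolding period_lattice_def by blast
  then have "x + y = of_int (m + m') * \<omega>1 + of_int (n + n') * \<omega>2"
    by (simp add: algebra_simps)
  then show ?thesis
    unfolding period_lattice_def by blast
qed

lemma period_lattice_uminus:
  assumes "x \<in> period_lattice \<omega>1 \<omega>2"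
  shows "- x \<in> period_lattice \<omega>1 \<omega>2"
proof -
  obtain m n where "x = of_int m * \<omega>1 + of_int n * \<omega>2"
    using assms unfolding period_lattice_def by blast
  then have "- x = of_int (- m) * \<omega>1 + of_int (- n) * \<omega>2"
    by simp
  then show ?thesis
    unfolding period_lattice_def by blast
qed

lemma period_lattice_uminus_iff [simp]: "- x \<in> period_lattice \<omega>1 \<omega>2 \<longleftrightarrow> x \<in> period_lattice \<omega>1 \<omega>2"
  using period_lattice_uminus[of x] period_lattice_uminus[of "- x"] by auto

lemma period_lattice_diff:
  "x \<in> period_lattice \<omega>1 \<omega>2 \<Longrightarrow> y \<in> period_lattice \<omega>1 \<omega>2 \<Longrightarrow> x - y \<in> period_lattice \<omega>1 \<omega>2"
  using period_lattice_add[of x _ _ "- y"] by simp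

lemma period_lattice_add_iff:
  "y \<in> period_lattice \<omega>1 \<omega>2 \<Longrightarrow> x + y \<in> period_lattice \<omega>1 \<omega>2 \<longleftrightarrow> x \<in> period_lattice \<omega>1 \<omega>2"
  using period_lattice_add[of x _ _ y] period_lattice_diff[of "x + y" _ _ y] by auto

lemma period_lattice_image:
  "period_lattice \<omega>1 \<omega>2 = (\<lambda>(m, n). of_int m * \<omega>1 + of_int n * \<omega>2) ` UNIV"
  unfolding period_lattice_def by auto

lemma countable_period_lattice: "countable (period_lattice \<omega>1 \<omega>2)"
  unfolding period_lattice_image by simp

lemma summable_on_int_powr: "(\<lambda>m::int. (1 + \<bar>of_int m\<bar>) powr (- 3 / 2) :: real) summable_on UNIV"
proof -
  let ?a = "\<lambda>m::int. (1 + \<bar>of_int m\<bar>) powr (- 3 / 2) :: real"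
  have "summable (\<lambda>n. real n powr (- 3 / 2))"
    by (subst summable_real_powr_iff) simp
  then have "summable (\<lambda>n. real (Suc n) powr (- 3 / 2))"
    by (subst summable_Suc_iff)
  then have nat: "(\<lambda>n. real (Suc n) powr (- 3 / 2)) summable_on UNIV"
    by (intro norm_summable_imp_summable_on) simp
  have "?a summable_on range int"
    by (subst summable_on_reindex) (use nat in \<open>auto simp: o_def add.commute\<close>)
  moreover have "?a summable_on range (\<lambda>n. - int n)"
    by (subst summable_on_reindex) (use nat in \<open>auto simp: o_def inj_def add.commute\<close>)
  ultimately have "?a summable_on (range int \<union> range (\<lambda>n. - int n))"
    by (rule summable_on_union)
  also have "range int \<union> range (\<lambda>n. - int n) = UNIV"
    by (auto simp: image_iff) (metis int_cases2)
  finally show ?thesis .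
qed

lemma summable_on_Times_product:
  fixes a b :: "'a \<Rightarrow> real"
  assumes "a summable_on A" "b summable_on B" "\<And>x. a x \<ge> 0" "\<And>x. b x \<ge> 0"
  shows "(\<lambda>(x, y). a x * b y) summable_on A \<times> B"
proof (rule summable_on_SigmaI)
  fix x
  have "((\<lambda>y. a x * b y) has_sum a x * infsum b B) B"
    by (intro has_sum_cmult_right has_sum_infsum assms)
  then show "((\<lambda>y. case (x, y) of (x, y) \<Rightarrow> a x * b y) has_sum a x * infsum b B) B"
    by simp
next
  show "(\<lambda>x. a x * infsum b B) summable_on A"
    by (intro summable_on_cmult_left assms)
qed (use assms in auto)

locale lattice_basis =
  fixes \<omega>1 \<omega>2 :: complex
  assumes independent: "\<omega>2 / \<omega>1 \<notin> \<real>"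
begin

abbreviation L :: "complex set" where "L \<equiv> period_lattice \<omega>1 \<omega>2"
abbreviation \<sigma> :: "complex \<Rightarrow> complex" where "\<sigma> \<equiv> weierstrass_sigma \<omega>1 \<omega>2"

lemma Im_nonzero: "Im (\<omega>2 * cnj \<omega>1) \<noteq> 0"
  using independent by (auto simp: complex_is_Real_iff Im_complex_div_eq_0 algebra_simps)

text \<open>
  Multiplication by \<open>cnj \<omega>1\<close> or by \<open>cnj \<omega>2\<close> makes one of the two terms real, so that the imaginary
  part isolates the other coefficient.
\<close>

lemma real_combination_norm_ge:
  obtains c where "c > 0" "\<And>x y :: real. c * (\<bar>x\<bar> + \<bar>y\<bar>) \<le> norm (of_real x * \<omega>1 + of_real y * \<omega>2)"
proof -
  define d where "d = \<bar>Im (\<omega>2 * cnj \<omega>1)\<bar>"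
  have "d > 0" and nz: "\<omega>1 \<noteq> 0"
    using Im_nonzero by (auto simp: d_def)
  define s where "s = norm \<omega>1 + norm \<omega>2"
  have "s > 0"
    using nz by (simp add: s_def add_pos_nonneg)
  have "d / s * (\<bar>x\<bar> + \<bar>y\<bar>) \<le> norm (of_real x * \<omega>1 + of_real y * \<omega>2)" for x y :: real
  proof -
    let ?w = "of_real x * \<omega>1 + of_real y * \<omega>2"
    have "\<bar>y\<bar> * d = \<bar>Im (?w * cnj \<omega>1)\<bar>"
      by (simp add: d_def abs_mult [symmetric] algebra_simps)
    also have "\<dots> \<le> norm ?w * norm \<omega>1"
      by (metis abs_Im_le_cmod norm_mult complex_mod_cnj)
    finally have 1: "\<bar>y\<bar> * d \<le> norm ?w * norm \<omega>1" .
    have "\<bar>x\<bar> * d = \<bar>Im (?w * cnj \<omega>2)\<bar>"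
      unfolding d_def abs_mult [symmetric] by (rule abs_eq_iff[THEN iffD2]) (simp add: algebra_simps)
    also have "\<dots> \<le> norm ?w * norm \<omega>2"
      by (metis abs_Im_le_cmod norm_mult complex_mod_cnj)
    finally have 2: "\<bar>x\<bar> * d \<le> norm ?w * norm \<omega>2" .
    show ?thesis
      using 1 2 \<open>s > 0\<close> by (simp add: s_def field_simps)
  qed
  then show ?thesis
    using that[of "d / s"] \<open>d > 0\<close> \<open>s > 0\<close> by simp
qed

lemma finite_period_lattice_cball: "finite {\<omega> \<in> L. norm \<omega> \<le> r}"
proof -
  obtain c where c: "c > 0" "\<And>x y :: real. c * (\<bar>x\<bar> + \<bar>y\<bar>) \<le> norm (of_real x * \<omega>1 + of_real y * \<omega>2)"
    using real_combination_norm_ge by blast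
  define k where "k = \<lceil>r / c\<rceil>"
  have "{\<omega> \<in> L. norm \<omega> \<le> r} \<subseteq> (\<lambda>(m, n). of_int m * \<omega>1 + of_int n * \<omega>2) ` ({-k..k} \<times> {-k..k})"
  proof
    fix \<omega> assume "\<omega> \<in> {\<omega> \<in> L. norm \<omega> \<le> r}"
    then obtain m n where mn: "\<omega> = of_int m * \<omega>1 + of_int n * \<omega>2" and r: "norm \<omega> \<le> r"
      unfolding period_lattice_def by blast
    have "c * (\<bar>of_int m\<bar> + \<bar>of_int n\<bar>) \<le> r"
      using c(2)[of "of_int m" "of_int n"] r mn by simp
    then have "\<bar>of_int m\<bar> + \<bar>of_int n\<bar> \<le> r / c"
      using c(1) by (simp add: field_simps)
    then have "\<bar>of_int m\<bar> \<le> r / c" "\<bar>of_int n\<bar> \<le> r / c"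
      by linarith+
    then have "\<bar>m\<bar> \<le> k" "\<bar>n\<bar> \<le> k"
      unfolding k_def by (simp_all add: le_ceiling_iff)
    then show "\<omega> \<in> (\<lambda>(m, n). of_int m * \<omega>1 + of_int n * \<omega>2) ` ({-k..k} \<times> {-k..k})"
      using mn by (auto intro!: image_eqI[of _ _ "(m, n)"])
  qed
  then show ?thesis
    by (rule finite_subset) auto
qed

text \<open>
  The norm of \<open>m \<omega>1 + n \<omega>2\<close> is at least a multiple of \<open>\<bar>m\<bar> + \<bar>n\<bar>\<close>, and
  \<open>(1 + \<bar>m\<bar>) (1 + \<bar>n\<bar>) \<le> 4 (\<bar>m\<bar> + \<bar>n\<bar>)\<^sup>2\<close>. This bounds the summand by a multiple of the product
  \<open>(1 + \<bar>m\<bar>)\<^bsup>-3/2\<^esup> (1 + \<bar>n\<bar>)\<^bsup>-3/2\<^esup>\<close>, which is summable over pairs.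
\<close>

lemma summable_on_inverse_cube: "(\<lambda>\<omega>. 1 / norm \<omega> ^ 3) summable_on (L - {0})"
proof -
  obtain c where c: "c > 0" "\<And>x y :: real. c * (\<bar>x\<bar> + \<bar>y\<bar>) \<le> norm (of_real x * \<omega>1 + of_real y * \<omega>2)"
    using real_combination_norm_ge by blast
  define \<phi> where "\<phi> = (\<lambda>(m::int, n::int). of_int m * \<omega>1 + of_int n * \<omega>2)"
  have ge: "c * (\<bar>of_int m\<bar> + \<bar>of_int n\<bar>) \<le> norm (\<phi> (m, n))" for m n
    using c(2)[of "of_int m" "of_int n"] by (simp add: \<phi>_def)
  have zero: "\<phi> p = 0 \<longleftrightarrow> p = (0, 0)" for p
  proof -
    obtain m n where p: "p = (m, n)" by force
    have "c * (\<bar>of_int m\<bar> + \<bar>of_int n\<bar>) \<le> 0" if "\<phi> p = 0"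
      using ge[of m n] that by (simp add: p)
    then have "\<bar>of_int m :: real\<bar> + \<bar>of_int n\<bar> \<le> 0" if "\<phi> p = 0"
      using c(1) that by (simp add: mult_le_0_iff)
    then have "m = 0 \<and> n = 0" if "\<phi> p = 0"
      using that by (smt (verit) of_int_eq_0_iff)
    then show ?thesis
      by (auto simp: p \<phi>_def)
  qed
  have inj: "inj \<phi>"
  proof (rule injI)
    fix p q assume eq: "\<phi> p = \<phi> q"
    have "\<phi> (fst p - fst q, snd p - snd q) = \<phi> p - \<phi> q"
      by (simp add: \<phi>_def case_prod_unfold algebra_simps)
    then show "p = q"
      using eq zero by (simp add: prod_eq_iff)
  qed
  let ?a = "\<lambda>m::int. (1 + \<bar>of_int m\<bar>) powr (- 3 / 2) :: real"
  have "(\<lambda>(m, n). ?a m * ?a n) summable_on (UNIV \<times> UNIV)"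
    by (intro summable_on_Times_product summable_on_int_powr) auto
  then have "(\<lambda>p. 8 / c ^ 3 * (case p of (m, n) \<Rightarrow> ?a m * ?a n)) summable_on (UNIV - {(0, 0)})"
    by (intro summable_on_cmult_right) (rule summable_on_subset_banach, auto)
  then have "(\<lambda>p. 1 / norm (\<phi> p) ^ 3) summable_on (UNIV - {(0, 0)})"
  proof (rule summable_on_comparison_test)
    fix p :: "int \<times> int" assume "p \<in> UNIV - {(0, 0)}"
    then obtain m n where p: "p = (m, n)" "(m, n) \<noteq> (0, 0)"
      by (cases p) auto
    define x y where "x = \<bar>real_of_int m\<bar>" and "y = \<bar>real_of_int n\<bar>"
    have "x + y \<ge> 1"
      using p(2) unfolding x_def y_def by auto
    have xy: "x \<ge> 0" "y \<ge> 0"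
      by (auto simp: x_def y_def)
    have "1 + x \<le> 2 * (x + y)" "1 + y \<le> 2 * (x + y)"
      using \<open>x + y \<ge> 1\<close> xy by auto
    then have "(1 + x) powr (3 / 2) * (1 + y) powr (3 / 2) \<le> (2 * (x + y)) powr (3 / 2) * (2 * (x + y)) powr (3 / 2)"
      using xy by (intro mult_mono powr_mono2) auto
    also have "\<dots> = (2 * (x + y)) powr 3"
      by (simp flip: powr_add)
    also have "\<dots> = 8 * (x + y) ^ 3"
    proof -
      have "(2 * t) powr 3 = 8 * t ^ 3" if "t \<ge> 1" for t :: real
        using that by (simp add: powr_numeral power_mult_distrib)
      then show ?thesis
        using \<open>x + y \<ge> 1\<close> by (simp only:)
    qed
    finally have le: "(1 + x) powr (3 / 2) * (1 + y) powr (3 / 2) \<le> 8 * (x + y) ^ 3" .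
    have "c * (x + y) \<le> norm (\<phi> p)"
      using ge[of m n] by (simp add: p x_def y_def)
    then have "(c * (x + y)) ^ 3 \<le> norm (\<phi> p) ^ 3"
      using c(1) xy by (intro power_mono) auto
    then have "1 / norm (\<phi> p) ^ 3 \<le> 1 / (c * (x + y)) ^ 3"
      using c(1) \<open>x + y \<ge> 1\<close> p(2) by (intro divide_left_mono) (auto intro!: mult_pos_pos zero_less_power simp: zero p)
    also have "\<dots> = 8 / c ^ 3 * (1 / (8 * (x + y) ^ 3))"
      by (simp add: power_mult_distrib)
    also have "\<dots> \<le> 8 / c ^ 3 * (1 / ((1 + x) powr (3 / 2) * (1 + y) powr (3 / 2)))"
      using le c(1) xy \<open>x + y \<ge> 1\<close>
      by (intro mult_left_mono divide_left_mono) (auto intro!: mult_pos_pos zero_less_power)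
    also have "\<dots> = 8 / c ^ 3 * (case p of (m, n) \<Rightarrow> ?a m * ?a n)"
      by (simp add: p x_def y_def powr_minus field_simps)
    finally show "1 / norm (\<phi> p) ^ 3 \<le> 8 / c ^ 3 * (case p of (m, n) \<Rightarrow> ?a m * ?a n)" .
  qed simp
  then have "((\<lambda>\<omega>. 1 / norm \<omega> ^ 3) \<circ> \<phi>) summable_on (UNIV - {(0, 0)})"
    by (simp add: o_def)
  then have "(\<lambda>\<omega>. 1 / norm \<omega> ^ 3) summable_on (\<phi> ` (UNIV - {(0, 0)}))"
    using inj by (subst summable_on_reindex) (auto intro: inj_on_subset)
  also have "\<phi> ` (UNIV - {(0, 0)}) = L - {0}"
    unfolding period_lattice_image \<phi>_def [symmetric] using zero by auto
  finally show ?thesis .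
qed

section \<open>The Weierstrass product\<close>

abbreviation factor :: "complex \<Rightarrow> complex \<Rightarrow> complex" where
  "factor \<omega> z \<equiv> weierstrass_factor 2 (z / \<omega>)"

abbreviation net :: "complex set filter" where
  "net \<equiv> finite_subsets_at_top (L - {0})"

lemma factor_eq: "factor \<omega> z = (1 - z / \<omega>) * exp (z / \<omega> + (z / \<omega>)\<^sup>2 / 2)"
  by (simp add: weierstrass_factor_def eval_nat_numeral)

lemma factor_eq_linear:
  assumes "\<omega> \<noteq> 0"
  shows "factor \<omega> z = (z - \<omega>) * (- 1 / \<omega> * exp (z / \<omega> + (z / \<omega>)\<^sup>2 / 2))"
proof -
  have "1 - z / \<omega> = (z - \<omega>) * (- 1 / \<omega>)"
    using assms by (simp add: diff_divide_distrib)
  then show ?thesis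
    unfolding factor_eq by (simp only: mult_ac)
qed

lemma norm_factor_minus_1:
  assumes "norm z \<le> R" "4 * R < norm \<omega>" "R > 0"
  shows "norm (factor \<omega> z - 1) \<le> 3 * R ^ 3 * (1 / norm \<omega> ^ 3)" "norm (factor \<omega> z - 1) < 1 / 2"
proof -
  have pos: "norm \<omega> > 0"
    using assms(2,3) by linarith
  have le: "norm (z / \<omega>) \<le> R / norm \<omega>"
    using assms pos by (simp add: norm_divide divide_right_mono)
  have small: "R / norm \<omega> < 1 / 4"
    using assms pos by (simp add: field_simps)
  have "norm (factor \<omega> z - 1) \<le> 3 * norm (z / \<omega>) ^ Suc 2"
    using le small by (intro weierstrass_factor_bound) linarith
  also have "\<dots> \<le> 3 * (R / norm \<omega>) ^ Suc 2"
    using le by (intro mult_left_mono power_mono) auto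
  finally have *: "norm (factor \<omega> z - 1) \<le> 3 * (R / norm \<omega>) ^ 3"
    by (simp add: numeral_3_eq_3)
  then show "norm (factor \<omega> z - 1) \<le> 3 * R ^ 3 * (1 / norm \<omega> ^ 3)"
    by (simp add: power_divide)
  have "(R / norm \<omega>) ^ 3 \<le> (1 / 4) ^ 3"
    using small assms(3) by (intro power_mono) auto
  with * show "norm (factor \<omega> z - 1) < 1 / 2"
    by (simp add: power_divide)
qed

text \<open>
  On a ball of radius \<open>R\<close>, the factors of the periods \<open>\<omega>\<close> with \<open>norm \<omega> > 4 * R\<close> are close to \<open>1\<close>. Their
  logarithms are dominated by \<open>1 / norm \<omega> ^ 3\<close>, so the sum of the logarithms converges uniformly along
  the net of finite sets, and the product of these factors is the exponential of a holomorphic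
  function. Convergence, holomorphy and the zeros of \<open>\<sigma>\<close> with their multiplicities all follow from
  this factorization.
\<close>

lemma local_factorization:
  assumes R: "R > 0"
  obtains g where "g holomorphic_on ball 0 R"
    and "\<And>z. z \<in> ball 0 R \<Longrightarrow> ((\<lambda>F. \<Prod>\<omega>\<in>F. factor \<omega> z) \<longlongrightarrow>
           (\<Prod>\<omega>\<in>{\<omega> \<in> L - {0}. norm \<omega> \<le> 4 * R}. factor \<omega> z) * exp (g z)) net"
proof -
  define X where "X = {\<omega> \<in> L - {0}. norm \<omega> \<le> 4 * R}"
  have X: "finite X" "X \<subseteq> L - {0}"
    unfolding X_def by (rule finite_subset[OF _ finite_period_lattice_cball[of "4 * R"]]) auto
  define h where "h = (\<lambda>\<omega> z. if \<omega> \<in> X then 0 else Ln (factor \<omega> z))"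
  define g where "g = (\<lambda>z. \<Sum>\<^sub>\<infinity>\<omega>\<in>L - {0}. h \<omega> z)"
  have far: "4 * R < norm \<omega>" if "\<omega> \<in> L - {0}" "\<omega> \<notin> X" for \<omega>
    using that by (auto simp: X_def)
  have half: "norm (factor \<omega> z - 1) < 1 / 2" if "\<omega> \<in> L - {0}" "\<omega> \<notin> X" "norm z \<le> R" for \<omega> z
    using norm_factor_minus_1(2)[OF that(3) far[OF that(1,2)] R] .
  have nonpos: "factor \<omega> z \<notin> \<real>\<^sub>\<le>\<^sub>0" if "\<omega> \<in> L - {0}" "\<omega> \<notin> X" "norm z \<le> R" for \<omega> z
  proof
    assume "factor \<omega> z \<in> \<real>\<^sub>\<le>\<^sub>0"
    then have "Re (factor \<omega> z) \<le> 0"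
      by (auto simp: complex_nonpos_Reals_iff)
    moreover have "\<bar>Re (factor \<omega> z - 1)\<bar> < 1 / 2"
      using half[OF that] abs_Re_le_cmod[of "factor \<omega> z - 1"] by linarith
    ultimately show False
      by simp
  qed
  have lim: "uniform_limit (cball 0 R) (\<lambda>F z. \<Sum>\<omega>\<in>F. h \<omega> z) g net"
    unfolding g_def
  proof (rule Weierstrass_m_test_general)
    show "(\<lambda>\<omega>. 6 * R ^ 3 * (1 / norm \<omega> ^ 3)) summable_on L - {0}"
      by (intro summable_on_cmult_right summable_on_inverse_cube)
    fix \<omega> z :: complex assume \<omega>: "\<omega> \<in> L - {0}" and z: "z \<in> cball 0 R"
    show "norm (h \<omega> z) \<le> 6 * R ^ 3 * (1 / norm \<omega> ^ 3)"
    proof (cases "\<omega> \<in> X")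
      case False
      have "norm (Ln (1 + (factor \<omega> z - 1))) \<le> 2 * norm (factor \<omega> z - 1)"
        using half[OF \<omega> False] z by (intro norm_Ln_le) simp
      also have "\<dots> \<le> 2 * (3 * R ^ 3 * (1 / norm \<omega> ^ 3))"
        using norm_factor_minus_1(1)[OF _ far[OF \<omega> False] R, of z] z by simp
      finally show ?thesis
        using False by (simp add: h_def)
    qed (use R in \<open>simp add: h_def\<close>)
  qed
  have ev: "\<forall>\<^sub>F F in net. continuous_on (cball 0 R) (\<lambda>z. \<Sum>\<omega>\<in>F. h \<omega> z)
      \<and> (\<lambda>z. \<Sum>\<omega>\<in>F. h \<omega> z) holomorphic_on ball 0 R"
  proof (rule eventually_finite_subsets_at_top_weakI)
    fix F assume F: "finite F" "F \<subseteq> L - {0}"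
    have "continuous_on (cball 0 R) (h \<omega>) \<and> h \<omega> holomorphic_on ball 0 R" if "\<omega> \<in> F" for \<omega>
    proof (cases "\<omega> \<in> X")
      case False
      have "\<omega> \<noteq> 0"
        using that F by auto
      have *: "continuous_on (cball 0 R) (\<lambda>z. Ln (factor \<omega> z))"
        by (intro continuous_intros) (use nonpos[OF _ False] F that \<open>\<omega> \<noteq> 0\<close> in auto)
      have "(\<lambda>z. Ln (factor \<omega> z)) holomorphic_on ball 0 R"
        by (intro holomorphic_intros) (use nonpos[OF _ False] F that \<open>\<omega> \<noteq> 0\<close> in \<open>auto simp: less_imp_le\<close>)
      with * show ?thesis
        using False by (simp add: h_def)
    qed (simp add: h_def)
    then show "continuous_on (cball 0 R) (\<lambda>z. \<Sum>\<omega>\<in>F. h \<omega> z)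
      \<and> (\<lambda>z. \<Sum>\<omega>\<in>F. h \<omega> z) holomorphic_on ball 0 R"
      by (auto intro!: continuous_on_sum holomorphic_on_sum)
  qed
  have hol: "g holomorphic_on ball 0 R"
    by (rule holomorphic_uniform_limit[OF ev lim]) auto
  have "((\<lambda>F. \<Prod>\<omega>\<in>F. factor \<omega> z) \<longlongrightarrow> (\<Prod>\<omega>\<in>X. factor \<omega> z) * exp (g z)) net" if z: "z \<in> ball 0 R" for z
  proof (rule Lim_transform_eventually)
    have "((\<lambda>F. \<Sum>\<omega>\<in>F. h \<omega> z) \<longlongrightarrow> g z) net"
      using lim by (rule tendsto_uniform_limitI) (use z in auto)
    then show "((\<lambda>F. (\<Prod>\<omega>\<in>X. factor \<omega> z) * exp (\<Sum>\<omega>\<in>F. h \<omega> z)) \<longlongrightarrow> (\<Prod>\<omega>\<in>X. factor \<omega> z) * exp (g z)) net"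
      by (intro tendsto_intros)
    show "\<forall>\<^sub>F F in net. (\<Prod>\<omega>\<in>X. factor \<omega> z) * exp (\<Sum>\<omega>\<in>F. h \<omega> z) = (\<Prod>\<omega>\<in>F. factor \<omega> z)"
      unfolding eventually_finite_subsets_at_top
    proof (intro exI[of _ X] conjI X allI impI)
      fix F assume F: "finite F \<and> X \<subseteq> F \<and> F \<subseteq> L - {0}"
      have "exp (\<Sum>\<omega>\<in>F. h \<omega> z) = (\<Prod>\<omega>\<in>F. exp (h \<omega> z))"
        using F by (simp add: exp_sum)
      also have "\<dots> = (\<Prod>\<omega>\<in>F - X. factor \<omega> z)"
      proof (rule prod.mono_neutral_cong_right)
        show "exp (h \<omega> z) = factor \<omega> z" if "\<omega> \<in> F - X" for \<omega>
        proof -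
          have "factor \<omega> z \<noteq> 0"
            using nonpos[of \<omega> z] that F z by fastforce
          then show ?thesis
            using that by (simp add: h_def)
        qed
      qed (use F in \<open>auto simp: h_def\<close>)
      finally have "(\<Prod>\<omega>\<in>X. factor \<omega> z) * exp (\<Sum>\<omega>\<in>F. h \<omega> z)
          = (\<Prod>\<omega>\<in>F - X. factor \<omega> z) * (\<Prod>\<omega>\<in>X. factor \<omega> z)"
        by simp
      also have "\<dots> = (\<Prod>\<omega>\<in>F. factor \<omega> z)"
        using F by (intro prod.subset_diff [symmetric]) auto
      finally show "(\<Prod>\<omega>\<in>X. factor \<omega> z) * exp (\<Sum>\<omega>\<in>F. h \<omega> z) = (\<Prod>\<omega>\<in>F. factor \<omega> z)" .
    qed
  qed
  then show ?thesis
    using that[OF hol] unfolding X_def by blast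
qed

lemma sigma_eq: "\<sigma> z = z * Lim net (\<lambda>F. \<Prod>\<omega>\<in>F. factor \<omega> z)"
  unfolding weierstrass_sigma_def factor_eq ..

lemma sigma_local_factorization:
  assumes "R > 0"
  obtains g where "g holomorphic_on ball 0 R"
    and "\<And>z. z \<in> ball 0 R \<Longrightarrow>
           \<sigma> z = z * (\<Prod>\<omega>\<in>{\<omega> \<in> L - {0}. norm \<omega> \<le> 4 * R}. factor \<omega> z) * exp (g z)"
proof -
  obtain g where g: "g holomorphic_on ball 0 R"
     "\<And>z. z \<in> ball 0 R \<Longrightarrow> ((\<lambda>F. \<Prod>\<omega>\<in>F. factor \<omega> z) \<longlongrightarrow>
           (\<Prod>\<omega>\<in>{\<omega> \<in> L - {0}. norm \<omega> \<le> 4 * R}. factor \<omega> z) * exp (g z)) net"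
    using local_factorization[OF assms] by blast
  then show ?thesis
    using that[OF g(1)] tendsto_Lim[OF _ g(2)] unfolding sigma_eq by (simp add: mult.assoc)
qed

lemma sigma_tendsto: "((\<lambda>F. z * (\<Prod>\<omega>\<in>F. factor \<omega> z)) \<longlongrightarrow> \<sigma> z) net"
proof -
  obtain g where 
     "\<And>z'. z' \<in> ball 0 (norm z + 1) \<Longrightarrow> ((\<lambda>F. \<Prod>\<omega>\<in>F. factor \<omega> z') \<longlongrightarrow>
           (\<Prod>\<omega>\<in>{\<omega> \<in> L - {0}. norm \<omega> \<le> 4 * (norm z + 1)}. factor \<omega> z') * exp (g z')) net"
    by (rule local_factorization[of "norm z + 1"]) (auto simp: add_nonneg_pos)
  from this[of z] obtain l where l: "((\<lambda>F. \<Prod>\<omega>\<in>F. factor \<omega> z) \<longlongrightarrow> l) net"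
    by auto
  then have "Lim net (\<lambda>F. \<Prod>\<omega>\<in>F. factor \<omega> z) = l"
    by (rule tendsto_Lim[rotated]) simp
  then show ?thesis
    unfolding sigma_eq using l by (auto intro: tendsto_mult)
qed

lemma sigma_holomorphic: "\<sigma> holomorphic_on UNIV"
proof -
  have "\<sigma> field_differentiable at z" for z
  proof -
    have R: "norm z + 1 > 0"
      by (simp add: add_nonneg_pos)
    obtain g where g: "g holomorphic_on ball 0 (norm z + 1)"
      "\<And>z'. z' \<in> ball 0 (norm z + 1) \<Longrightarrow>
         \<sigma> z' = z' * (\<Prod>\<omega>\<in>{\<omega> \<in> L - {0}. norm \<omega> \<le> 4 * (norm z + 1)}. factor \<omega> z') * exp (g z')"
      using sigma_local_factorization[OF R] by blast
    have "(\<lambda>z'. z' * (\<Prod>\<omega>\<in>{\<omega> \<in> L - {0}. norm \<omega> \<le> 4 * (norm z + 1)}. factor \<omega> z') * exp (g z'))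
      holomorphic_on ball 0 (norm z + 1)"
      by (intro holomorphic_intros g(1)) auto
    then have "\<sigma> holomorphic_on ball 0 (norm z + 1)"
      by (rule holomorphic_transform) (use g(2) in auto)
    then show ?thesis
      by (rule holomorphic_on_imp_differentiable_at) auto
  qed
  then show ?thesis
    by (simp add: holomorphic_on_def field_differentiable_at_within)
qed

lemma sigma_zero_iff: "\<sigma> z = 0 \<longleftrightarrow> z \<in> L"
proof -
  have R: "norm z + 1 > 0"
    by (simp add: add_nonneg_pos)
  obtain g where g: "\<And>z'. z' \<in> ball 0 (norm z + 1) \<Longrightarrow>
     \<sigma> z' = z' * (\<Prod>\<omega>\<in>{\<omega> \<in> L - {0}. norm \<omega> \<le> 4 * (norm z + 1)}. factor \<omega> z') * exp (g z')"
    using sigma_local_factorization[OF R] by blast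
  have fin: "finite {\<omega> \<in> L - {0}. norm \<omega> \<le> 4 * (norm z + 1)}"
    by (rule finite_subset[OF _ finite_period_lattice_cball[of "4 * (norm z + 1)"]]) auto
  have "\<sigma> z = 0 \<longleftrightarrow> z = 0 \<or> (\<exists>\<omega>\<in>{\<omega> \<in> L - {0}. norm \<omega> \<le> 4 * (norm z + 1)}. z / \<omega> = 1)"
    using g[of z] fin by simp
  also have "\<dots> \<longleftrightarrow> z \<in> L"
    by (auto simp: divide_eq_1_iff intro!: bexI[of _ z])
  finally show ?thesis .
qed

text \<open>
  In the local factorization exactly one factor vanishes at \<open>p\<close>, and it vanishes to first order.
\<close>

lemma sigma_simple_zero:
  assumes "p \<in> L"
  shows "deriv \<sigma> p \<noteq> 0"
proof -
  define R where "R = norm p + 1"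
  have R: "R > 0"
    by (simp add: R_def add_nonneg_pos)
  define X where "X = {\<omega> \<in> L - {0}. norm \<omega> \<le> 4 * R}"
  have X: "finite X" "0 \<notin> X"
    unfolding X_def by (rule finite_subset[OF _ finite_period_lattice_cball[of "4 * R"]]) auto
  obtain g where g: "g holomorphic_on ball 0 R"
      "\<And>z. z \<in> ball 0 R \<Longrightarrow> \<sigma> z = z * (\<Prod>\<omega>\<in>X. factor \<omega> z) * exp (g z)"
    unfolding X_def using sigma_local_factorization[OF R] by blast
  have "\<exists>k. k holomorphic_on ball 0 R \<and> k p \<noteq> 0 \<and> (\<forall>z\<in>ball 0 R. \<sigma> z = (z - p) * k z)"
  proof (cases "p = 0")
    case True
    have "(\<lambda>z. (\<Prod>\<omega>\<in>X. factor \<omega> z) * exp (g z)) holomorphic_on ball 0 R"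
      by (intro holomorphic_intros g) (use X in auto)
    then show ?thesis
      by (intro exI[of _ "\<lambda>z. (\<Prod>\<omega>\<in>X. factor \<omega> z) * exp (g z)"]) (use g(2) X True in auto)
  next
    case False
    define k where "k = (\<lambda>z. z * (- 1 / p * exp (z / p + (z / p)\<^sup>2 / 2)) * (\<Prod>\<omega>\<in>X - {p}. factor \<omega> z) * exp (g z))"
    have "k holomorphic_on ball 0 R"
      unfolding k_def by (intro holomorphic_intros g) (use X False in auto)
    moreover have "k p \<noteq> 0"
      unfolding k_def using X False by auto
    moreover have "p \<in> X"
      using assms False by (simp add: X_def R_def)
    moreover have "\<sigma> z = (z - p) * k z" if "z \<in> ball 0 R" for z
    proof -
      have "(\<Prod>\<omega>\<in>X. factor \<omega> z) = factor p z * (\<Prod>\<omega>\<in>X - {p}. factor \<omega> z)"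
        by (rule prod.remove[OF X(1) \<open>p \<in> X\<close>])
      then show ?thesis
        unfolding g(2)[OF that] k_def using factor_eq_linear[OF False] by (simp only: mult_ac)
    qed
    ultimately show ?thesis
      by blast
  qed
  then obtain k where k: "k holomorphic_on ball 0 R" "k p \<noteq> 0" "\<And>z. z \<in> ball 0 R \<Longrightarrow> \<sigma> z = (z - p) * k z"
    by blast
  have p: "p \<in> ball 0 R"
    by (simp add: R_def)
  have "(k has_field_derivative deriv k p) (at p)"
    using holomorphic_derivI[OF k(1) open_ball p] .
  then have "((\<lambda>z. (z - p) * k z) has_field_derivative (p - p) * deriv k p + 1 * k p) (at p)"
    by (auto intro!: derivative_eq_intros)
  then have "((\<lambda>z. (z - p) * k z) has_field_derivative k p) (at p)"
    by simp
  then have "(\<sigma> has_field_derivative k p) (at p)"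
    by (rule has_field_derivative_transform_within_open[OF _ open_ball p]) (simp add: k(3))
  then show ?thesis
    using k(2) by (simp add: DERIV_imp_deriv)
qed

section \<open>Quasi-periodicity of the sigma function\<close>

definition partial_sigma :: "complex set \<Rightarrow> complex \<Rightarrow> complex" where
  "partial_sigma F z = z * (\<Prod>\<omega>\<in>F. factor \<omega> z)"

lemma partial_sigma_tendsto:
  assumes "filterlim \<Phi> net net"
  shows "((\<lambda>F. partial_sigma (\<Phi> F) z) \<longlongrightarrow> \<sigma> z) net"
  unfolding partial_sigma_def by (rule filterlim_compose[OF sigma_tendsto assms])

lemma sigma_odd: "\<sigma> (- z) = - \<sigma> z"
proof (rule tendsto_unique)
  have neg: "filterlim (\<lambda>F. uminus ` F) net net"
    unfolding filterlim_finite_subsets_at_top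
  proof (intro allI impI)
    fix X assume X: "finite X \<and> X \<subseteq> L - {0}"
    show "\<forall>\<^sub>F F in net. finite (uminus ` F) \<and> X \<subseteq> uminus ` F \<and> uminus ` F \<subseteq> L - {0}"
      unfolding eventually_finite_subsets_at_top
    proof (intro exI[of _ "uminus ` X"] conjI allI impI)
      fix F assume "finite F \<and> uminus ` X \<subseteq> F \<and> F \<subseteq> L - {0}"
      moreover from this have "uminus ` uminus ` X \<subseteq> uminus ` F"
        by blast
      ultimately show "finite (uminus ` F)" "X \<subseteq> uminus ` F" "uminus ` F \<subseteq> L - {0}"
        by (auto simp: image_image)
    qed (use X in auto)
  qed
  have "partial_sigma F (- z) = - partial_sigma (uminus ` F) z" for F
    by (simp add: partial_sigma_def prod.reindex inj_on_def)
  then show "((\<lambda>F. partial_sigma F (- z)) \<longlongrightarrow> - \<sigma> z) net"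
    using tendsto_minus[OF partial_sigma_tendsto[OF neg, of z]] by simp
  show "((\<lambda>F. partial_sigma F (- z)) \<longlongrightarrow> \<sigma> (- z)) net"
    by (rule partial_sigma_tendsto[OF filterlim_ident])
qed simp

lemma partial_sigma_eq:
  assumes "finite F" "0 \<notin> F"
  obtains C \<alpha> \<beta> where
    "\<And>z. partial_sigma F z = C * exp (\<alpha> * z + \<beta> * z\<^sup>2) * (\<Prod>\<omega>\<in>insert 0 F. z - \<omega>)"
proof -
  have fac: "factor \<omega> z = (- 1 / \<omega>) * exp (1 / \<omega> * z + 1 / (2 * \<omega>\<^sup>2) * z\<^sup>2) * (z - \<omega>)" if "\<omega> \<in> F" for \<omega> z
  proof -
    have "z / \<omega> + (z / \<omega>)\<^sup>2 / 2 = 1 / \<omega> * z + 1 / (2 * \<omega>\<^sup>2) * z\<^sup>2"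
      by (simp add: power_divide)
    moreover have "\<omega> \<noteq> 0"
      using assms that by auto
    note factor_eq_linear[OF this, of z]
    ultimately show ?thesis
      by (simp only: mult_ac)
  qed
  have "(\<Prod>\<omega>\<in>F. factor \<omega> z) = (\<Prod>\<omega>\<in>F. - 1 / \<omega>) *
     exp ((\<Sum>\<omega>\<in>F. 1 / \<omega>) * z + (\<Sum>\<omega>\<in>F. 1 / (2 * \<omega>\<^sup>2)) * z\<^sup>2) * (\<Prod>\<omega>\<in>F. z - \<omega>)" for z
  proof -
    have "(\<Prod>\<omega>\<in>F. factor \<omega> z)
        = (\<Prod>\<omega>\<in>F. (- 1 / \<omega>) * exp (1 / \<omega> * z + 1 / (2 * \<omega>\<^sup>2) * z\<^sup>2) * (z - \<omega>))"
      by (intro prod.cong refl fac)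
    also have "\<dots> = (\<Prod>\<omega>\<in>F. - 1 / \<omega>) * exp (\<Sum>\<omega>\<in>F. 1 / \<omega> * z + 1 / (2 * \<omega>\<^sup>2) * z\<^sup>2) * (\<Prod>\<omega>\<in>F. z - \<omega>)"
      unfolding exp_sum[OF assms(1)] by (simp only: prod.distrib)
    finally show ?thesis
      by (simp only: sum.distrib sum_distrib_right)
  qed
  then have "partial_sigma F z = (\<Prod>\<omega>\<in>F. - 1 / \<omega>) *
     exp ((\<Sum>\<omega>\<in>F. 1 / \<omega>) * z + (\<Sum>\<omega>\<in>F. 1 / (2 * \<omega>\<^sup>2)) * z\<^sup>2) * (\<Prod>\<omega>\<in>insert 0 F. z - \<omega>)" for z
    unfolding partial_sigma_def using assms by (simp add: mult_ac)
  then show ?thesis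
    by (rule that)
qed

text \<open>
  A partial product is a polynomial times the exponential of a quadratic polynomial. By the symmetry
  of \<open>F\<close>, the zeros of the polynomial at \<open>z + \<omega>\<close> are those at \<open>- z\<close>. The relation with four values is
  chosen so that the exponentials cancel as well: the quadratic terms of the two sides differ by
  \<open>2 * \<beta> * \<omega> * (u + v - u' - v') = 0\<close>.
\<close>

lemma partial_sigma_quasi_period:
  assumes F: "finite F" "0 \<notin> F" and sym: "(\<lambda>\<eta>. \<omega> - \<eta>) ` insert 0 F = insert 0 F"
    and sum: "u + v = u' + v'"
  shows "partial_sigma F (u + \<omega>) * partial_sigma F (v + \<omega>) * partial_sigma F (- u') * partial_sigma F (- v')
    = partial_sigma F (- u) * partial_sigma F (- v) * partial_sigma F (u' + \<omega>) * partial_sigma F (v' + \<omega>)"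
proof -
  obtain C \<alpha> \<beta> where ps:
    "\<And>z. partial_sigma F z = C * exp (\<alpha> * z + \<beta> * z\<^sup>2) * (\<Prod>\<eta>\<in>insert 0 F. z - \<eta>)"
    using partial_sigma_eq[OF F] by blast
  define p where "p z = (\<Prod>\<eta>\<in>insert 0 F. z - \<eta>)" for z
  define \<epsilon> where "\<epsilon> = (- 1 :: complex) ^ card (insert 0 F)"
  have p: "p (z + \<omega>) = \<epsilon> * p (- z)" for z
  proof -
    have "p (z + \<omega>) = (\<Prod>\<eta>\<in>(\<lambda>\<eta>. \<omega> - \<eta>) ` insert 0 F. z + \<omega> - \<eta>)"
      unfolding p_def sym ..
    also have "\<dots> = (\<Prod>\<eta>\<in>insert 0 F. - (- z - \<eta>))"
      by (subst prod.reindex) (auto simp: inj_on_def o_def simp del: prod.insert intro!: prod.cong)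
    also have "\<dots> = \<epsilon> * p (- z)"
      unfolding p_def \<epsilon>_def by (rule prod_uminus)
    finally show ?thesis .
  qed
  define ex where "ex z = exp (\<alpha> * z + \<beta> * z\<^sup>2)" for z
  have v': "v' = u + v - u'"
    using sum by algebra
  have ex: "ex (u + \<omega>) * ex (v + \<omega>) * ex (- u') * ex (- v') = ex (- u) * ex (- v) * ex (u' + \<omega>) * ex (v' + \<omega>)"
    unfolding ex_def exp_add [symmetric] v' by (rule arg_cong[of _ _ exp]) algebra
  have ps': "partial_sigma F z = C * ex z * p z" for z
    unfolding ps ex_def p_def ..
  show ?thesis
    unfolding ps' p using ex by algebra
qed

text \<open>
  The finite sets that are symmetric about \<open>\<omega>/2\<close> are cofinal among all finite sets of periods, so the
  relation for partial products passes to the limit. It expresses that the multiplier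
  \<open>\<sigma> (z + \<omega>) / \<sigma> z\<close> is the exponential of a polynomial of degree at most one in \<open>z\<close>.
\<close>

lemma sigma_quasi_period:
  assumes \<omega>: "\<omega> \<in> L" and sum: "u + v = u' + v'"
  shows "\<sigma> (u + \<omega>) * \<sigma> (v + \<omega>) * \<sigma> u' * \<sigma> v' = \<sigma> u * \<sigma> v * \<sigma> (u' + \<omega>) * \<sigma> (v' + \<omega>)"
proof -
  define \<Phi> where "\<Phi> F = {0, \<omega>} \<union> F \<union> (\<lambda>\<eta>. \<omega> - \<eta>) ` F - {0}" for F
  have lim: "filterlim \<Phi> net net"
    unfolding filterlim_finite_subsets_at_top eventually_finite_subsets_at_top
  proof (intro allI impI)
    fix X assume X: "finite X \<and> X \<subseteq> L - {0}"
    show "\<exists>Y. finite Y \<and> Y \<subseteq> L - {0} \<and> (\<forall>F. finite F \<and> Y \<subseteq> F \<and> F \<subseteq> L - {0} \<longrightarrow>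
       finite (\<Phi> F) \<and> X \<subseteq> \<Phi> F \<and> \<Phi> F \<subseteq> L - {0})"
      by (rule exI[of _ X]) (use X \<omega> in \<open>auto simp: \<Phi>_def intro: period_lattice_diff\<close>)
  qed
  have "\<sigma> (u + \<omega>) * \<sigma> (v + \<omega>) * \<sigma> (- u') * \<sigma> (- v') = \<sigma> (- u) * \<sigma> (- v) * \<sigma> (u' + \<omega>) * \<sigma> (v' + \<omega>)"
  proof (rule tendsto_unique[of net])
    show "((\<lambda>F. partial_sigma (\<Phi> F) (u + \<omega>) * partial_sigma (\<Phi> F) (v + \<omega>) * partial_sigma (\<Phi> F) (- u')
        * partial_sigma (\<Phi> F) (- v')) \<longlongrightarrow> \<sigma> (u + \<omega>) * \<sigma> (v + \<omega>) * \<sigma> (- u') * \<sigma> (- v')) net"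
      by (intro tendsto_intros partial_sigma_tendsto lim)
    have "((\<lambda>F. partial_sigma (\<Phi> F) (- u) * partial_sigma (\<Phi> F) (- v) * partial_sigma (\<Phi> F) (u' + \<omega>)
        * partial_sigma (\<Phi> F) (v' + \<omega>)) \<longlongrightarrow> \<sigma> (- u) * \<sigma> (- v) * \<sigma> (u' + \<omega>) * \<sigma> (v' + \<omega>)) net"
      by (intro tendsto_intros partial_sigma_tendsto lim)
    moreover have "\<forall>\<^sub>F F in net. partial_sigma (\<Phi> F) (- u) * partial_sigma (\<Phi> F) (- v)
        * partial_sigma (\<Phi> F) (u' + \<omega>) * partial_sigma (\<Phi> F) (v' + \<omega>)
       = partial_sigma (\<Phi> F) (u + \<omega>) * partial_sigma (\<Phi> F) (v + \<omega>) * partial_sigma (\<Phi> F) (- u')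
        * partial_sigma (\<Phi> F) (- v')"
    proof (rule eventually_finite_subsets_at_top_weakI)
      fix F :: "complex set" assume F: "finite F"
      have ins: "insert 0 (\<Phi> F) = {0, \<omega>} \<union> F \<union> (\<lambda>\<eta>. \<omega> - \<eta>) ` F"
        by (auto simp: \<Phi>_def)
      have "(\<lambda>\<eta>. \<omega> - \<eta>) ` insert 0 (\<Phi> F) = insert 0 (\<Phi> F)"
        unfolding ins image_Un image_image by (auto simp: image_Un)
      then show "partial_sigma (\<Phi> F) (- u) * partial_sigma (\<Phi> F) (- v)
        * partial_sigma (\<Phi> F) (u' + \<omega>) * partial_sigma (\<Phi> F) (v' + \<omega>)
       = partial_sigma (\<Phi> F) (u + \<omega>) * partial_sigma (\<Phi> F) (v + \<omega>) * partial_sigma (\<Phi> F) (- u')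
        * partial_sigma (\<Phi> F) (- v')"
        using partial_sigma_quasi_period[OF _ _ _ sum, of "\<Phi> F" \<omega>] F by (simp add: \<Phi>_def)
    qed
    ultimately show "((\<lambda>F. partial_sigma (\<Phi> F) (u + \<omega>) * partial_sigma (\<Phi> F) (v + \<omega>) * partial_sigma (\<Phi> F) (- u')
        * partial_sigma (\<Phi> F) (- v')) \<longlongrightarrow> \<sigma> (- u) * \<sigma> (- v) * \<sigma> (u' + \<omega>) * \<sigma> (v' + \<omega>)) net"
      by (rule Lim_transform_eventually)
  qed simp
  then show ?thesis
    by (simp add: sigma_odd)
qed

end

section \<open>The three-term relation for the sigma function\<close>

text \<open>
  Near a zero \<open>p\<close> of \<open>S\<close>, both \<open>D\<close> and \<open>S\<close> can be divided by \<open>x - p\<close>, after which the denominator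
  no longer vanishes at \<open>p\<close>.
\<close>

lemma entire_quotient:
  assumes D: "D holomorphic_on UNIV" and S: "S holomorphic_on UNIV"
    and zero: "\<And>p. S p = 0 \<Longrightarrow> D p = 0 \<and> deriv S p \<noteq> 0"
  obtains Q :: "complex \<Rightarrow> complex"
    where "Q holomorphic_on UNIV" "\<And>x. S x \<noteq> 0 \<Longrightarrow> Q x = D x / S x"
proof -
  define Q where "Q x = (if S x = 0 then deriv D x / deriv S x else D x / S x)" for x
  have "Q field_differentiable at p" for p
  proof (cases "S p = 0")
    case False
    have "open {x. S x \<noteq> 0}"
      using holomorphic_on_imp_continuous_on[OF S] by (intro open_Collect_neq continuous_intros)
    moreover have "(\<lambda>x. D x / S x) holomorphic_on {x. S x \<noteq> 0}"
      by (intro holomorphic_intros holomorphic_on_subset[OF D] holomorphic_on_subset[OF S]) auto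
    then have "Q holomorphic_on {x. S x \<noteq> 0}"
      by (rule holomorphic_transform) (simp add: Q_def)
    ultimately show ?thesis
      using False by (intro holomorphic_on_imp_differentiable_at) auto
  next
    case True
    define D1 where "D1 x = (if x = p then deriv D p else (D x - D p) / (x - p))" for x
    define S1 where "S1 x = (if x = p then deriv S p else (S x - S p) / (x - p))" for x
    have D1: "D1 holomorphic_on UNIV" and S1: "S1 holomorphic_on UNIV"
      unfolding D1_def S1_def using pole_lemma[OF D, of p] pole_lemma[OF S, of p] by simp_all
    have "S1 p \<noteq> 0"
      using zero[OF True] by (simp add: S1_def)
    have "open {x. S1 x \<noteq> 0}"
      using holomorphic_on_imp_continuous_on[OF S1] by (intro open_Collect_neq continuous_intros)
    moreover have "(\<lambda>x. D1 x / S1 x) holomorphic_on {x. S1 x \<noteq> 0}"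
      by (intro holomorphic_intros holomorphic_on_subset[OF D1] holomorphic_on_subset[OF S1]) auto
    then have "Q holomorphic_on {x. S1 x \<noteq> 0}"
      by (rule holomorphic_transform) (use zero[OF True] True in \<open>auto simp: Q_def D1_def S1_def\<close>)
    ultimately show ?thesis
      using \<open>S1 p \<noteq> 0\<close> by (intro holomorphic_on_imp_differentiable_at) auto
  qed
  then have "Q holomorphic_on UNIV"
    by (simp add: holomorphic_on_def field_differentiable_at_within)
  then show ?thesis
    by (rule that) (simp add: Q_def)
qed

context lattice_basis
begin

text \<open>
  The values of \<open>Q\<close> are already taken on a compact period parallelogram, so \<open>Q\<close> is bounded.
\<close>

lemma elliptic_entire_constant:
  assumes Q: "Q holomorphic_on UNIV" and per: "\<And>x \<omega>. \<omega> \<in> L \<Longrightarrow> Q (x + \<omega>) = Q x"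
  shows "Q constant_on UNIV"
proof (rule Liouville_theorem[OF Q])
  define K where "K = (\<lambda>(a, b). of_real a * \<omega>1 + of_real b * \<omega>2) ` ({0..1} \<times> {0..1::real})"
  have "compact K"
    unfolding K_def case_prod_unfold by (intro compact_continuous_image continuous_intros compact_Times) auto
  then have "bounded (Q ` K)"
    by (intro compact_imp_bounded compact_continuous_image continuous_on_subset[OF holomorphic_on_imp_continuous_on[OF Q]]) auto
  moreover have "range Q \<subseteq> Q ` K"
  proof
    fix y assume "y \<in> range Q"
    then obtain x where y: "y = Q x" by blast
    define b where "b = Im (x * cnj \<omega>1) / Im (\<omega>2 * cnj \<omega>1)"
    have nz: "\<omega>1 \<noteq> 0"
      using Im_nonzero by auto
    define a where "a = Re ((x - of_real b * \<omega>2) / \<omega>1)"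
    have "Im ((x - of_real b * \<omega>2) * cnj \<omega>1) = Im (x * cnj \<omega>1) - b * Im (\<omega>2 * cnj \<omega>1)"
      by (simp add: algebra_simps)
    also have "\<dots> = 0"
      using Im_nonzero by (simp add: b_def)
    finally have "Im ((x - of_real b * \<omega>2) / \<omega>1) = 0"
      by (simp add: Im_complex_div_eq_0)
    then have "(x - of_real b * \<omega>2) / \<omega>1 = of_real a"
      by (simp add: a_def complex_eq_iff)
    then have x: "x = of_real a * \<omega>1 + of_real b * \<omega>2"
      using nz by (simp add: field_simps)
    define k where "k = of_real (frac a) * \<omega>1 + of_real (frac b) * \<omega>2"
    have "x = k + (of_int \<lfloor>a\<rfloor> * \<omega>1 + of_int \<lfloor>b\<rfloor> * \<omega>2)"
      by (simp add: x k_def frac_def algebra_simps)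
    moreover have "of_int \<lfloor>a\<rfloor> * \<omega>1 + of_int \<lfloor>b\<rfloor> * \<omega>2 \<in> L"
      unfolding period_lattice_def by blast
    ultimately have "Q x = Q k"
      using per by simp
    moreover have "k \<in> K"
      unfolding K_def k_def by (rule image_eqI[of _ _ "(frac a, frac b)"]) (auto simp: frac_lt_1 less_imp_le)
    ultimately show "y \<in> Q ` K"
      using y by blast
  qed
  ultimately show "bounded (range Q)"
    by (rule bounded_subset)
qed

text \<open>
  The building block of the three-term relation. For all \<open>t\<close> these functions have the same
  quasi-periodicity, so their quotients are elliptic.
\<close>

definition sigma_pair :: "complex \<Rightarrow> complex \<Rightarrow> complex" where
  "sigma_pair t x = \<sigma> (x + t) * \<sigma> (x - t)"

lemma sigma_pair_holomorphic: "sigma_pair t holomorphic_on UNIV"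
  unfolding sigma_pair_def
  by (intro holomorphic_intros holomorphic_on_compose_gen[OF _ sigma_holomorphic, unfolded o_def]) auto

lemma sigma_pair_zero_iff: "sigma_pair t x = 0 \<longleftrightarrow> x + t \<in> L \<or> x - t \<in> L"
  by (simp add: sigma_pair_def sigma_zero_iff)

lemma sigma_pair_quasi_period: "\<omega> \<in> L \<Longrightarrow> sigma_pair t (x + \<omega>) * sigma_pair r x = sigma_pair t x * sigma_pair r (x + \<omega>)"
  using sigma_quasi_period[of \<omega> "x + t" "x - t" "x + r" "x - r"]
  by (simp add: sigma_pair_def algebra_simps)

text \<open>
  If \<open>p + t\<close> and \<open>p - t\<close> were both periods, then so would be their difference \<open>2 * t\<close>.
\<close>

lemma deriv_sigma_pair_nonzero:
  assumes "2 * t \<notin> L" "sigma_pair t p = 0"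
  shows "deriv (sigma_pair t) p \<noteq> 0"
proof -
  have d: "(\<sigma> has_field_derivative deriv \<sigma> x) (at x)" for x
    using holomorphic_derivI[OF sigma_holomorphic, of x] by simp
  have "((\<lambda>x. \<sigma> (x + t)) has_field_derivative deriv \<sigma> (p + t)) (at p)"
    using d[of "p + t"] by (simp add: DERIV_shift)
  moreover have "((\<lambda>x. \<sigma> (x - t)) has_field_derivative deriv \<sigma> (p - t)) (at p)"
    using d[of "p + - t"] unfolding DERIV_shift by simp
  ultimately have "(sigma_pair t has_field_derivative (deriv \<sigma> (p + t) * \<sigma> (p - t) + deriv \<sigma> (p - t) * \<sigma> (p + t))) (at p)"
    unfolding sigma_pair_def by (rule DERIV_mult)
  then have D: "deriv (sigma_pair t) p = deriv \<sigma> (p + t) * \<sigma> (p - t) + deriv \<sigma> (p - t) * \<sigma> (p + t)"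
    by (rule DERIV_imp_deriv)
  have "\<not> (p + t \<in> L \<and> p - t \<in> L)"
    using period_lattice_diff[of "p + t" \<omega>1 \<omega>2 "p - t"] assms(1) by auto
  moreover have "p + t \<in> L \<or> p - t \<in> L"
    using assms(2) by (simp add: sigma_pair_zero_iff)
  ultimately show ?thesis
    unfolding D
    using sigma_zero_iff[of "p + t"] sigma_zero_iff[of "p - t"] sigma_simple_zero[of "p + t"]
      sigma_simple_zero[of "p - t"] by auto
qed

text \<open>
  As a function of \<open>x\<close>, the left-hand side \<open>D\<close> has the quasi-periodicity of \<open>sigma_pair z\<close> and vanishes
  at \<open>z\<close>, at \<open>- z\<close> and at \<open>w\<close>. Modulo periods, \<open>z\<close> and \<open>- z\<close> are the only zeros of \<open>sigma_pair z\<close>, and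
  they are simple. So the quotient \<open>Q\<close> is entire and elliptic, hence constant, and it vanishes at \<open>w\<close>.
\<close>

lemma sigma_three_term_generic:
  assumes z: "2 * z \<notin> L" and w: "z + w \<notin> L" "z - w \<notin> L"
  shows "\<sigma> (x + y) * \<sigma> (x - y) * \<sigma> (z + w) * \<sigma> (z - w)
      + \<sigma> (x + z) * \<sigma> (x - z) * \<sigma> (w + y) * \<sigma> (w - y)
      + \<sigma> (x + w) * \<sigma> (x - w) * \<sigma> (y + z) * \<sigma> (y - z) = 0"
proof -
  define D where "D x = sigma_pair y x * sigma_pair w z + sigma_pair z x * sigma_pair y w + sigma_pair w x * sigma_pair z y" for x
  have sym: "sigma_pair t r = - sigma_pair r t" for t r
  proof -
    have "\<sigma> (r - t) = - \<sigma> (t - r)"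
      using sigma_odd[of "t - r"] by simp
    then show ?thesis
      by (simp add: sigma_pair_def add.commute)
  qed
  have neg: "sigma_pair t (- x) = sigma_pair t x" for t x
  proof -
    have "\<sigma> (- x + t) = - \<sigma> (x - t)" "\<sigma> (- x - t) = - \<sigma> (x + t)"
      using sigma_odd[of "x - t"] sigma_odd[of "x + t"] by simp_all
    then show ?thesis
      by (simp add: sigma_pair_def)
  qed
  have self: "sigma_pair t t = 0" for t
    by (simp add: sigma_pair_zero_iff)
  have Dz: "D z = 0" and Dw: "D w = 0"
    unfolding D_def self using sym[of z y] sym[of w z] sym[of w y] by algebra+
  have Dneg: "D (- x) = D x" for x
    by (simp add: D_def neg)
  have wz: "sigma_pair w z \<noteq> 0" 
    using w by (simp add: sigma_pair_zero_iff)
  have Dq: "D (x + \<omega>) * sigma_pair r x = D x * sigma_pair r (x + \<omega>)" if "\<omega> \<in> L" for x r \<omega>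
    unfolding D_def using sigma_pair_quasi_period[OF that, of y x r] sigma_pair_quasi_period[OF that, of z x r]
      sigma_pair_quasi_period[OF that, of w x r] by algebra
  \<comment> \<open>The zeros of \<open>D\<close> at \<open>z\<close> and \<open>- z\<close> are carried to all their translates by quasi-periodicity,\<close>
  \<comment> \<open>where \<open>sigma_pair w\<close> serves as a comparison function that does not vanish at \<open>z\<close> and \<open>- z\<close>.\<close>
  have D0: "D p = 0" if "sigma_pair z p = 0" for p
  proof -
    have *: "D (x + \<omega>) = 0" if "\<omega> \<in> L" "x = z \<or> x = - z" for x \<omega>
    proof -
      have "D x = 0" "sigma_pair w x \<noteq> 0"
        using that(2) Dz wz by (auto simp: Dneg neg)
      then show ?thesis
        using Dq[OF that(1), of x w] by simp
    qed
    from that have "p + z \<in> L \<or> p - z \<in> L"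
      by (simp add: sigma_pair_zero_iff)
    then show ?thesis
      using *[of "p + z" "- z"] *[of "p - z" z] by auto
  qed
  have Dhol: "D holomorphic_on UNIV"
    unfolding D_def by (intro holomorphic_intros sigma_pair_holomorphic)
  obtain Q where Q: "Q holomorphic_on UNIV" "\<And>x. sigma_pair z x \<noteq> 0 \<Longrightarrow> Q x = D x / sigma_pair z x"
    using entire_quotient[OF Dhol sigma_pair_holomorphic[of z]] D0 deriv_sigma_pair_nonzero[OF z] by blast
  have "Q (x + \<omega>) = Q x" if \<omega>: "\<omega> \<in> L" for x \<omega>
  proof -
    \<comment> \<open>Periodicity is immediate away from the countably many zeros of the denominator.\<close>
    have "uncountable {x. Q (x + \<omega>) = Q x}"
    proof
      assume "countable {x. Q (x + \<omega>) = Q x}"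
      moreover have "countable ((\<lambda>l. l - z) ` L \<union> (\<lambda>l. l + z) ` L)"
        by (intro countable_Un countable_image countable_period_lattice)
      moreover have "x \<in> {x. Q (x + \<omega>) = Q x} \<union> ((\<lambda>l. l - z) ` L \<union> (\<lambda>l. l + z) ` L)" for x
      proof (cases "sigma_pair z x = 0")
        case True
        then have "x + z \<in> L \<or> x - z \<in> L"
          by (simp add: sigma_pair_zero_iff)
        then show ?thesis
          by (force simp: image_iff)
      next
        case False
        have "sigma_pair z (x + \<omega>) \<noteq> 0"
          using False period_lattice_add_iff[OF \<omega>, of "x + z"] period_lattice_add_iff[OF \<omega>, of "x - z"]
          by (simp add: sigma_pair_zero_iff algebra_simps)
        then have "Q (x + \<omega>) = Q x"
          using False Dq[OF \<omega>, of x z] by (simp add: Q(2) frac_eq_eq)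
        then show ?thesis
          by simp
      qed
      ultimately have "countable (UNIV :: complex set)"
        by (metis countable_Un countable_subset subsetI)
      then show False
        using uncountable_UNIV_complex by simp
    qed
    then have "(\<lambda>x. Q (x + \<omega>)) = Q"
      by (intro holomorphic_countable_equal_UNIV Q(1)
           holomorphic_on_compose_gen[OF _ Q(1), unfolded o_def] holomorphic_intros) auto
    then show ?thesis
      by metis
  qed
  then have "Q constant_on UNIV"
    by (intro elliptic_entire_constant Q(1))
  then obtain q where q: "Q x = q" for x
    unfolding constant_on_def by auto
  have "sigma_pair z w \<noteq> 0"
    using wz sym[of z w] by simp
  then have "q = 0"
    using Q(2)[of w] Dw q by simp
  then have "D x = 0"
    using D0[of x] Q(2)[of x] q[of x] by (cases "sigma_pair z x = 0") auto
  then show ?thesis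
    by (simp add: D_def sigma_pair_def mult.assoc)
qed

text \<open>
  The excluded values of \<open>z\<close> form a countable set, and the left-hand side is entire in \<open>z\<close>.
\<close>

lemma sigma_three_term:
  "\<sigma> (x + y) * \<sigma> (x - y) * \<sigma> (z + w) * \<sigma> (z - w)
      + \<sigma> (x + z) * \<sigma> (x - z) * \<sigma> (w + y) * \<sigma> (w - y)
      + \<sigma> (x + w) * \<sigma> (x - w) * \<sigma> (y + z) * \<sigma> (y - z) = 0"
proof -
  define D where "D z = \<sigma> (x + y) * \<sigma> (x - y) * \<sigma> (z + w) * \<sigma> (z - w)
      + \<sigma> (x + z) * \<sigma> (x - z) * \<sigma> (w + y) * \<sigma> (w - y)
      + \<sigma> (x + w) * \<sigma> (x - w) * \<sigma> (y + z) * \<sigma> (y - z)" for z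
  have "D = (\<lambda>_. 0)"
  proof (rule holomorphic_countable_equal_UNIV)
    show "D holomorphic_on UNIV"
      unfolding D_def
      by (intro holomorphic_intros holomorphic_on_compose_gen[OF _ sigma_holomorphic, unfolded o_def]) auto
    show "uncountable {z. D z = 0}"
    proof
      let ?B = "(\<lambda>l. l / 2) ` L \<union> (\<lambda>l. l - w) ` L \<union> (\<lambda>l. l + w) ` L"
      assume "countable {z. D z = 0}"
      moreover have "countable ?B"
        by (intro countable_Un countable_image countable_period_lattice)
      moreover have "z \<in> {z. D z = 0} \<union> ?B" for z
      proof (cases "2 * z \<in> L \<or> z + w \<in> L \<or> z - w \<in> L")
        case True
        then have "z \<in> ?B"
          by (auto intro: image_eqI[of z "\<lambda>l. l / 2" "2 * z"] image_eqI[of z "\<lambda>l. l - w" "z + w"]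
                image_eqI[of z "\<lambda>l. l + w" "z - w"])
        then show ?thesis ..
      next
        case False
        then show ?thesis
          unfolding D_def using sigma_three_term_generic[of z w x y] by simp
      qed
      ultimately have "countable (UNIV :: complex set)"
        by (metis countable_Un countable_subset subsetI)
      then show False
        using uncountable_UNIV_complex by simp
    qed
  qed simp
  then show ?thesis
    unfolding D_def by metis
qed

end

section \<open>Invariance of the normalized series\<close>

lemma prod_atMost_5: "(\<Prod>k\<le>5. f k) = f 0 * f 1 * f 2 * f 3 * f 4 * f (5::nat)"
  for f :: "nat \<Rightarrow> complex"
  by (simp add: eval_nat_numeral)

lemma ell_hyp_series_permute:
  assumes "mset us = mset vs"
  shows "ell_hyp_series \<omega>1 \<omega>2 \<delta> s us = ell_hyp_series \<omega>1 \<omega>2 \<delta> s vs"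
proof -
  have "(\<Prod>u\<leftarrow>us. g u) = (\<Prod>u\<leftarrow>vs. g u)" for g :: "complex \<Rightarrow> complex"
    using assms by (simp flip: prod_mset_prod_list)
  then show ?thesis
    by (simp add: ell_hyp_series_def)
qed

lemma E_tilde_s_transf:
  assumes "k \<in> {1..5}"
  shows "E_tilde \<omega>1 \<omega>2 N (s_transf k v) = E_tilde \<omega>1 \<omega>2 N v"
proof -
  obtain s c \<delta> where v: "v = (s, c, \<delta>)"
    by (cases v)
  have k: "k \<in> {1, 2, 3, 4, 5}"
    using assms by auto
  have "mset (series_params N (s_transf k v)) = mset (series_params N v)"
    using k by (auto simp: v)
  then have series: "ell_hyp_series \<omega>1 \<omega>2 \<delta> s (series_params N (s_transf k v)) = ell_hyp_series \<omega>1 \<omega>2 \<delta> s (series_params N v)"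
    by (rule ell_hyp_series_permute)
  have "(\<Prod>i\<le>5. h (fst (snd (s_transf k v)) i)) = (\<Prod>i\<le>5. h (c i))" for h :: "complex \<Rightarrow> complex"
    using k by (auto simp: v prod_atMost_5 mult_ac)
  from this[of "\<lambda>u. sigma_pochhammer \<omega>1 \<omega>2 \<delta> (\<delta> + s - u) N"] series show ?thesis
    by (simp add: v)
qed

context lattice_basis
begin

text \<open>
  The values \<open>\<delta> + s - c\<^sub>k\<close> for \<open>k \<le> 2\<close> are the same before and after the transformation, because
  the new parameter is \<open>l + c\<^sub>k - s\<close> over the new base \<open>l\<close>. For \<open>3 \<le> k \<le> 5\<close> the parameters stay, and
  the quotient of the corresponding factors is the factor in Bailey's transformation.
\<close>

lemma E_tilde_b_transf:
  assumes gen: "generic \<omega>1 \<omega>2 N v" and gen': "generic \<omega>1 \<omega>2 N (b_transf v)" and bal: "balanced N v"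
  shows "E_tilde \<omega>1 \<omega>2 N (b_transf v) = E_tilde \<omega>1 \<omega>2 N v"
proof -
  obtain s c \<delta> where v: "v = (s, c, \<delta>)"
    by (cases v)
  interpret odd_three_term \<sigma> \<delta>
    by unfold_locales (rule sigma_odd, rule sigma_three_term)
  have poch: "sigma_pochhammer \<omega>1 \<omega>2 \<delta> = poch"
    by (intro ext) (simp add: sigma_pochhammer_def poch_def)
  define l where "l = 2 * s + \<delta> - c 0 - c 1 - c 2"
  have series: "ell_hyp_series \<omega>1 \<omega>2 \<delta> r us = (\<Sum>m\<le>N. very_well_poised_term r us m)"
    if "- of_nat N * \<delta> \<in> set us" for r us
    unfolding ell_hyp_series_terminates[OF that] very_well_poised_term_def poch ..
  have params: "s + \<delta> - c 1 - c 2 = l + c 0 - s" "s + \<delta> - c 0 - c 2 = l + c 1 - s"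
    "s + \<delta> - c 0 - c 1 = l + c 2 - s"
    by (simp_all add: l_def)
  have bv: "b_transf v = (l, c(0 := l + c 0 - s, 1 := l + c 1 - s, 2 := l + c 2 - s), \<delta>)"
    unfolding v b_transf.simps l_def [symmetric] params ..
  have \<delta>0: "poch \<delta> N \<noteq> 0" and s0: "\<sigma> s \<noteq> 0" and l0: "\<sigma> l \<noteq> 0"
    and sN: "poch (s + \<delta>) N \<noteq> 0" and lN: "poch (l + \<delta>) N \<noteq> 0"
    and c0: "\<forall>x\<in>{c 0, c 1, c 2}. poch (s + \<delta> - x) N \<noteq> 0"
    and c3: "\<forall>x\<in>{c 3, c 4, c 5}. poch (s + \<delta> - x) N \<noteq> 0 \<and> poch (l + \<delta> - x) N \<noteq> 0"
    and s2N: "poch (s + \<delta> + of_nat N * \<delta>) N \<noteq> 0" and l2N: "poch (l + \<delta> + of_nat N * \<delta>) N \<noteq> 0"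
    using gen gen' unfolding bv unfolding v by (auto simp: poch add.commute)
  \<comment> \<open>The second half of the factors comes from the denominators that belong to the parameter \<open>-N\<delta>\<close>.\<close>
  have "poch (s + \<delta>) (2 * N) \<noteq> 0" "poch (l + \<delta>) (2 * N) \<noteq> 0"
    using sN s2N lN l2N by (simp_all add: mult_2 poch_add)
  moreover have "c 3 + c 4 + c 5 = s + l + of_nat (Suc N) * \<delta>"
  proof -
    have "c 5 = (2 + of_nat N) * \<delta> + 3 * s - c 0 - c 1 - c 2 - c 3 - c 4"
      using bal by (simp add: v sum_atMost_5 algebra_simps)
    then show ?thesis
      by (simp add: l_def algebra_simps)
  qed
  ultimately have transf: "(\<Sum>m\<le>N. very_well_poised_term s [c 0, c 1, c 2, c 3, c 4, c 5, - of_nat N * \<delta>] m)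
    = poch (s + \<delta>) N / poch (l + \<delta>) N
        * (poch (l + \<delta> - c 3) N / poch (s + \<delta> - c 3) N * (poch (l + \<delta> - c 4) N / poch (s + \<delta> - c 4) N)
          * (poch (l + \<delta> - c 5) N / poch (s + \<delta> - c 5) N))
      * (\<Sum>m\<le>N. very_well_poised_term l [l + c 0 - s, l + c 1 - s, l + c 2 - s, c 3, c 4, c 5, - of_nat N * \<delta>] m)"
    (is "_ = _ * ?S")
    by (intro bailey_transformation \<delta>0 s0 l0 c0 c3 l_def)
  have sw: "\<delta> + x - y = x + \<delta> - y" "l + \<delta> - (l + x - s) = s + \<delta> - x" for x y
    by simp_all
  have "E_tilde \<omega>1 \<omega>2 N v
    = poch (s + \<delta> - c 0) N * poch (s + \<delta> - c 1) N * poch (s + \<delta> - c 2) N * poch (s + \<delta> - c 3) N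
      * poch (s + \<delta> - c 4) N * poch (s + \<delta> - c 5) N / poch (s + \<delta>) N
      * (\<Sum>m\<le>N. very_well_poised_term s [c 0, c 1, c 2, c 3, c 4, c 5, - of_nat N * \<delta>] m)"
    unfolding v E_tilde.simps series_params.simps prod_atMost_5 poch sw add.commute[of \<delta> s]
    by (subst series) simp_all
  also have "\<dots> = poch (s + \<delta> - c 0) N * poch (s + \<delta> - c 1) N * poch (s + \<delta> - c 2) N * poch (l + \<delta> - c 3) N
      * poch (l + \<delta> - c 4) N * poch (l + \<delta> - c 5) N / poch (l + \<delta>) N * ?S"
    unfolding transf using sN c3 by simp
  also have "\<dots> = E_tilde \<omega>1 \<omega>2 N (b_transf v)"
    unfolding bv E_tilde.simps series_params.simps prod_atMost_5 poch add.commute[of \<delta> l]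
    by (subst series) (simp_all add: sw)
  finally show ?thesis ..
qed

end

theorem proposition3p1:
  fixes \<omega>1 \<omega>2 s \<delta> :: complex and c :: "nat \<Rightarrow> complex" and N :: nat and v :: params
  assumes "\<omega>2 / \<omega>1 \<notin> \<real>"
    and "\<not> (\<exists>p\<in>\<rat>. \<exists>q\<in>\<rat>. \<delta> = p * \<omega>1 + q * \<omega>2)"
    and "v = (s, c, \<delta>)"
    and "generic \<omega>1 \<omega>2 N v"
    and "balanced N v"
  shows "(generic \<omega>1 \<omega>2 N (b_transf v) \<longrightarrow>
            E_tilde \<omega>1 \<omega>2 N (b_transf v) = E_tilde \<omega>1 \<omega>2 N v) \<and>
         (\<forall>k\<in>{1..5}. E_tilde \<omega>1 \<omega>2 N (s_transf k v) = E_tilde \<omega>1 \<omega>2 N v)"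
proof (intro conjI impI ballI)
  interpret lattice_basis \<omega>1 \<omega>2
    by unfold_locales (rule assms(1))
  show "E_tilde \<omega>1 \<omega>2 N (b_transf v) = E_tilde \<omega>1 \<omega>2 N v" if "generic \<omega>1 \<omega>2 N (b_transf v)"
    using E_tilde_b_transf[OF assms(4) that assms(5)] .
qed (rule E_tilde_s_transf)

end
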